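(* Assume A.3 and A.4 (stated in the context). If $\max_{j\notin\mathcal{M}_*}\|\mathbf{u}_j\|_\infty=O(n^{-\eta})$ where $\eta>\kappa$, and $\min_{j\notin\mathcal{M}_*}\lambda_{\min}\big(\mathbb{E}\{\mathbf{g}^{(j)}(\mathbf{Z};0)\mathbf{g}^{(j)}(\mathbf{Z};0)^{\mathrm T}\}\big)\ge c_4$ for some $c_4>0$, where $\lambda_{\min}(A)$ means the smallest eigenvalue of $A$, then there exists a positive constant $C_5$ depending only on $K_3,K_4,\gamma_3$ of assumption A.4 and $c_4$ such that, for any $\tau\in(\frac12-\eta,\frac12-\kappa)$ and $\gamma_n=c_3n^{2\tau}$, $$\mathbb{P}\{|\widehat{\mathcal{M}}_{\gamma_n}|>s\}\le \begin{cases} p\exp(-C_5n^{2\tau})+p\exp(-C_5n^{\gamma_3/6}), & \text{if } \gamma_3<2 \text{ and } \eta>\frac14,\\ p\exp(-C_5n^{\gamma_3\eta})+p\exp(-C_5n^{\gamma_3/6}), & \text{if } \gamma_3<2 \text{ and } \eta\le\frac14,\\ p\exp(-C_5n^{\gamma_3\eta})+p\exp(-C_5n^{\gamma_3/6}), & \text{if } \gamma_3\ge2 \text{ and } \eta\le\frac1{\gamma_3+2},\\ p\exp(-C_5n^{\gamma_3/(\gamma_3+2)})+p\exp(-C_5n^{2\tau}), & \text{if } \gamma_3\ge4 \text{ and } \eta>\frac1{\gamma_3+2},\\ p\exp(-C_5n^{\gamma_3/6})+p\exp(-C_5n^{2\tau}), & \text{if } 2\le\gamma_3<4 \text{ and }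 \eta>\frac1{\gamma_3+2}. \end{cases}$$
   Context: Setting. $\mathbf{Z}_1,\ldots,\mathbf{Z}_n$ are i.i.d. copies of a random vector $\mathbf{Z}\in\mathbb{R}^d$; $\boldsymbol\beta=(\beta_1,\ldots,\beta_p)^{\mathrm T}\in\mathbb{R}^p$ is the parameter of interest, and $\mathbf{g}(\mathbf{Z};\boldsymbol\beta)=(g_1(\mathbf{Z};\boldsymbol\beta),\ldots,g_r(\mathbf{Z};\boldsymbol\beta))^{\mathrm T}$ is an $r$-dimensional estimating function with $\mathbb{E}\{\mathbf{g}(\mathbf{Z};\boldsymbol\beta)\}=\mathbf{0}$ at the true $\boldsymbol\beta$. Dimensions may depend on $n$. The true model is $\mathcal{M}_*=\{1\le j\le p:\beta_j\ne0\}$, with $s=|\mathcal{M}_*|$. Marginal estimating functions. For $j=1,\ldots,p$ and $\beta\in\mathbb{R}$ let $\boldsymbol\beta^{(j)}=(0,\ldots,0,\beta,0,\ldots,0)^{\mathrm T}\in\mathbb{R}^p$ with $\beta$ in position $j$. $\mathbf{g}^{(j)}(\mathbf{Z};\beta)=(g^{(j)}_1(\mathbf{Z};\beta),\ldots,g^{(j)}_{r_j}(\mathbf{Z};\beta))^{\mathrm T}$ denotes the $r_j$-dimensional ($r_j\ge1$) function collecting the components of $\mathbf{g}(\mathbf{Z};\boldsymbol\beta^{(j)})$ that depend on the unknown parameter $\beta$. Write $\mathbf{u}_j=\mathbb{E}\{\mathbf{g}^{(j)}(\mathbf{Z};0)\}$ for $j=1,\ldots,p$. Marginal empirical likelihood.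 $\mathrm{EL}_j(0)=\sup\{\prod_{i=1}^nw_i:w_i\ge0,\ \sum_{i=1}^nw_i=1,\ \sum_{i=1}^nw_i\mathbf{g}^{(j)}(\mathbf{Z}_i;0)=\mathbf{0}\}$ (with $\sup\emptyset=0$), and $\ell_j(0)=-2\log\{\mathrm{EL}_j(0)\}-2n\log n$, with $\ell_j(0)=\infty$ if $\mathbf{0}$ is not in the convex hull of $\{\mathbf{g}^{(j)}(\mathbf{Z}_i;0)\}_{i=1}^n$ (convention $\log0=-\infty$). For a threshold $\gamma_n$, $\widehat{\mathcal{M}}_{\gamma_n}=\{1\le j\le p:\ell_j(0)\ge\gamma_n\}$, with cardinality $|\widehat{\mathcal{M}}_{\gamma_n}|$. Norms: $\|\mathbf{a}\|_\infty=\max_i|a_i|$ and $\|\mathbf{a}\|_2=(\sum_ia_i^2)^{1/2}$. A.3: There exists a positive constant $c_3$ such that $\min_{j\in\mathcal{M}_*}\|\mathbb{E}\{\mathbf{g}^{(j)}(\mathbf{Z};0)\}\|_\infty\ge c_3n^{-\kappa}$ for some $\kappa\in[0,\frac12)$. A.4: There are positive constants $K_3,K_4,\gamma_3$ such that $\mathbb{P}\{\|\mathbf{g}^{(j)}(\mathbf{Z};0)\|_2\ge u\}\le K_3\exp(-K_4u^{\gamma_3})$ for each $j=1,\ldots,p$ and any $u>0$.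
   Formalization: In the three cases containing exp(-C_5 n^{2τ}), C_5 may also depend on c_3, since independence of c_3 fails (Gaussian example with small c_3); the bounds are stated for all sufficiently large n, and the true model M_* is assumed nonempty. *)

theory Defs
  imports
    "HOL-Probability.Probability"
    "HOL-Library.Landau_Symbols"
    "Jordan_Normal_Form.Char_Poly"
begin

text \<open>
  Since the dimensions vary with the sample size, a point of Euclidean \<open>k\<close>-space is a function in
  \<open>space (euclid k)\<close>: real-valued on \<open>{1..k}\<close> and \<open>undefined\<close> outside.
\<close>

abbreviation euclid :: "nat \<Rightarrow> (nat \<Rightarrow> real) measure" where
  "euclid k \<equiv> PiM {1..k} (\<lambda>_. borel)"

text \<open>
  The model for one sample size. \<open>estf m z b k\<close> is the \<open>k\<close>-th component of the estimating function
  at the observation \<open>z\<close> and the parameter \<open>b\<close>; \<open>par\<close> is the true parameter; \<open>obs\<close> is the generic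
  random vector and \<open>sample m i\<close> its \<open>i\<close>-th copy.
\<close>

record 'a ee_model =
  prob_sp :: "'a measure"
  dim_obs :: nat
  dim_par :: nat
  dim_est :: nat
  estf :: "(nat \<Rightarrow> real) \<Rightarrow> (nat \<Rightarrow> real) \<Rightarrow> nat \<Rightarrow> real"
  par :: "nat \<Rightarrow> real"
  obs :: "'a \<Rightarrow> nat \<Rightarrow> real"
  sample :: "nat \<Rightarrow> 'a \<Rightarrow> nat \<Rightarrow> real"

definition coord_par :: "nat \<Rightarrow> nat \<Rightarrow> real \<Rightarrow> nat \<Rightarrow> real" where
  "coord_par p j b = (\<lambda>l\<in>{1..p}. if l = j then b else 0)"

definition marg_comps :: "'a ee_model \<Rightarrow> nat \<Rightarrow> nat set" where
  "marg_comps m j = {k \<in> {1..dim_est m}.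
     \<exists>z \<in> space (euclid (dim_obs m)). \<exists>b b'.
       estf m z (coord_par (dim_par m) j b) k \<noteq> estf m z (coord_par (dim_par m) j b') k}"

definition marg_est :: "'a ee_model \<Rightarrow> nat \<Rightarrow> (nat \<Rightarrow> real) \<Rightarrow> real \<Rightarrow> real Matrix.vec" where
  "marg_est m j z b = Matrix.vec (card (marg_comps m j))
     (\<lambda>i. estf m z (coord_par (dim_par m) j b) (sorted_list_of_set (marg_comps m j) ! i))"

definition true_model :: "'a ee_model \<Rightarrow> nat set" where
  "true_model m = {j \<in> {1..dim_par m}. par m j \<noteq> 0}"

definition valid_model :: "nat \<Rightarrow> 'a ee_model \<Rightarrow> bool" where
  "valid_model n m \<longleftrightarrow>
     prob_space (prob_sp m) \<and>
     obs m \<in> measurable (prob_sp m) (euclid (dim_obs m)) \<and>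
     prob_space.indep_vars (prob_sp m) (\<lambda>_. euclid (dim_obs m)) (sample m) {1..n} \<and>
     (\<forall>i\<in>{1..n}. distr (prob_sp m) (euclid (dim_obs m)) (sample m i)
                = distr (prob_sp m) (euclid (dim_obs m)) (obs m)) \<and>
     par m \<in> space (euclid (dim_par m)) \<and>
     (\<forall>k\<in>{1..dim_est m}. \<forall>b\<in>space (euclid (dim_par m)).
        (\<lambda>z. estf m z b k) \<in> borel_measurable (euclid (dim_obs m))) \<and>
     (\<forall>k\<in>{1..dim_est m}.
        integrable (prob_sp m) (\<lambda>\<omega>. estf m (obs m \<omega>) (par m) k) \<and>
        (\<integral>\<omega>. estf m (obs m \<omega>) (par m) k \<partial>prob_sp m) = 0) \<and>
     (\<forall>j\<in>{1..dim_par m}. card (marg_comps m j) \<ge> 1)"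

definition norm_inf :: "real Matrix.vec \<Rightarrow> real" where
  "norm_inf v = Max ((\<lambda>i. \<bar>vec_index v i\<bar>) ` {..<dim_vec v})"

definition norm_two :: "real Matrix.vec \<Rightarrow> real" where
  "norm_two v = sqrt (\<Sum>i<dim_vec v. (vec_index v i)\<^sup>2)"

definition marg_mean :: "'a ee_model \<Rightarrow> nat \<Rightarrow> real Matrix.vec" where
  "marg_mean m j = Matrix.vec (card (marg_comps m j))
     (\<lambda>i. \<integral>\<omega>. vec_index (marg_est m j (obs m \<omega>) 0) i \<partial>prob_sp m)"

definition marg_second_moment :: "'a ee_model \<Rightarrow> nat \<Rightarrow> real Matrix.mat" where
  "marg_second_moment m j = Matrix.mat (card (marg_comps m j)) (card (marg_comps m j))
     (\<lambda>(k, l). \<integral>\<omega>. vec_index (marg_est m j (obs m \<omega>) 0) k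
                  * vec_index (marg_est m j (obs m \<omega>) 0) l \<partial>prob_sp m)"

text \<open>Only used for real symmetric matrices of positive dimension, which have a real eigenvalue.\<close>

definition lambda_min :: "real Matrix.mat \<Rightarrow> real" where
  "lambda_min A = Min {k. eigenvalue A k}"

text \<open>
  The elements of the set are nonnegative, so inserting \<open>0\<close> only implements the convention that the
  supremum of the empty set is \<open>0\<close>.
\<close>

definition marg_EL :: "nat \<Rightarrow> 'a ee_model \<Rightarrow> nat \<Rightarrow> 'a \<Rightarrow> real" where
  "marg_EL n m j \<omega> = Sup (insert 0 {\<Prod>i\<in>{1..n}. w i | w :: nat \<Rightarrow> real.
     (\<forall>i\<in>{1..n}. w i \<ge> 0) \<and> (\<Sum>i\<in>{1..n}. w i) = 1 \<and>
     (\<forall>k<card (marg_comps m j).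
        (\<Sum>i\<in>{1..n}. w i * vec_index (marg_est m j (sample m i \<omega>) 0) k) = 0)})"

text \<open>
  The first case is the convention that the logarithm of \<open>0\<close> is minus infinity. It covers the case
  that \<open>0\<close> is outside the convex hull of the data, where no weights are feasible.
\<close>

definition marg_ELR :: "nat \<Rightarrow> 'a ee_model \<Rightarrow> nat \<Rightarrow> 'a \<Rightarrow> ereal" where
  "marg_ELR n m j \<omega> = (if marg_EL n m j \<omega> = 0 then \<infinity>
     else ereal (- 2 * ln (marg_EL n m j \<omega>) - 2 * real n * ln (real n)))"

definition selected :: "nat \<Rightarrow> 'a ee_model \<Rightarrow> real \<Rightarrow> 'a \<Rightarrow> nat set" where
  "selected n m \<gamma> \<omega> = {j \<in> {1..dim_par m}. marg_ELR n m j \<omega> \<ge> ereal \<gamma>}"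

text \<open>The minimum over the true model presupposes that the true model is nonempty.\<close>

definition min_signal :: "(nat \<Rightarrow> 'a ee_model) \<Rightarrow> real \<Rightarrow> real \<Rightarrow> bool" where
  "min_signal m c \<kappa> \<longleftrightarrow> c > 0 \<and> 0 \<le> \<kappa> \<and> \<kappa> < 1/2 \<and>
     (\<forall>n\<ge>1. true_model (m n) \<noteq> {} \<and>
        Min ((\<lambda>j. norm_inf (marg_mean (m n) j)) ` true_model (m n)) \<ge> c * real n powr (- \<kappa>))"

definition tail_bound :: "(nat \<Rightarrow> 'a ee_model) \<Rightarrow> real \<Rightarrow> real \<Rightarrow> real \<Rightarrow> bool" where
  "tail_bound m K\<^sub>3 K\<^sub>4 \<gamma>\<^sub>3 \<longleftrightarrow>
     (\<forall>n\<ge>1. \<forall>j\<in>{1..dim_par (m n)}. \<forall>u>0.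
        measure (prob_sp (m n))
          {\<omega> \<in> space (prob_sp (m n)). norm_two (marg_est (m n) j (obs (m n) \<omega>) 0) \<ge> u}
        \<le> K\<^sub>3 * exp (- K\<^sub>4 * u powr \<gamma>\<^sub>3))"

text \<open>
  If all coordinates are in the true model there is nothing to bound: the inserted \<open>0\<close> and the
  bounded quantifier below make both conditions hold in that case.
\<close>

definition null_mean_max :: "'a ee_model \<Rightarrow> real" where
  "null_mean_max m =
     Max (insert 0 ((\<lambda>j. norm_inf (marg_mean m j)) ` ({1..dim_par m} - true_model m)))"

definition null_eigen_bound :: "(nat \<Rightarrow> 'a ee_model) \<Rightarrow> real \<Rightarrow> bool" where
  "null_eigen_bound m c \<longleftrightarrow>
     (\<forall>n\<ge>1. \<forall>j\<in>{1..dim_par (m n)} - true_model (m n).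
        lambda_min (marg_second_moment (m n) j) \<ge> c)"

definition overselect_prob :: "nat \<Rightarrow> 'a ee_model \<Rightarrow> real \<Rightarrow> real" where
  "overselect_prob n m \<gamma> = measure (prob_sp m)
     {\<omega> \<in> space (prob_sp m). card (selected n m \<gamma> \<omega>) > card (true_model m)}"

end

theory Submission
  imports
    Defs
    "HOL-Real_Asymp.Real_Asymp"
    "Jordan_Normal_Form.Spectral_Radius"
begin

text \<open>
  Overselection forces \<open>\<ell>\<^sub>j(0) \<ge> \<gamma>\<^sub>n\<close> for some coordinate \<open>j\<close> outside the true model, so a union bound
  reduces the theorem to one null coordinate. Write \<open>X\<^sub>i\<close> for its marginal estimating function at the
  \<open>i\<close>-th observation.

  A single feasible weight vector bounds \<open>\<ell>\<^sub>j(0)\<close> from above. The weights used here are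
  \<open>n w\<^sub>i = 1 - b \<bullet> (Y\<^sub>i - mean Y)\<close>, where \<open>Y\<^sub>i\<close> equals \<open>X\<^sub>i\<close> if \<open>X\<^sub>i\<close> has norm at most a constant \<open>L\<close>, and
  is \<open>0\<close> otherwise, and where \<open>b\<close> solves the linear system that makes \<open>\<Sum>w\<^sub>i X\<^sub>i\<close> vanish. Tilting along the
  clipped vectors instead of the \<open>X\<^sub>i\<close> keeps the weights positive as soon as the sample mean of the
  \<open>X\<^sub>i\<close> is below a constant, however large the largest \<open>X\<^sub>i\<close> is. If the Gram matrix of the
  \<open>Y\<^sub>i\<close> is bounded below, the system is coercive and \<open>\<ell>\<^sub>j(0) \<le> const * n * |mean X|\<^sup>2\<close>
  (\<open>tilted_weights\<close>, \<open>marg_ELR_le\<close>).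

  With \<open>L\<close> large in terms of \<open>K\<^sub>3, K\<^sub>4, \<gamma>\<^sub>3, c\<^sub>4\<close>, clipping costs at most a quarter of the eigenvalue
  bound \<open>c\<^sub>4\<close> (\<open>clipped_second_moment\<close>), and since the clipped vectors are bounded, their Gram matrix is
  close to its expectation outside an event of probability of order \<open>exp (- const * n)\<close>. The dimension does not
  enter the constants, because the eigenvalue bound and the tail bound together bound it (\<open>dim_le\<close>).

  It remains to bound the probability that the sample mean of the \<open>X\<^sub>i\<close> exceeds a multiple of
  \<open>n powr (\<tau> - 1/2)\<close>. As \<open>\<tau> > 1/2 - \<eta>\<close>, its expectation is of smaller order. Truncation at \<open>n powr \<rho>\<close>
  with \<open>\<rho> = min (1/6) (1/(\<gamma>\<^sub>3 + 2))\<close> and an inequality of Bernstein type for the truncated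
  variables (\<open>bernstein_two_sided\<close>) produce the rates \<open>n powr (\<rho> * \<gamma>\<^sub>3)\<close>, \<open>n powr (2 * \<tau>)\<close> and
  \<open>n powr (1 - 2 * \<rho>)\<close>.

  Comparing exponents gives the five regimes. Only the rate \<open>n powr (2 * \<tau>)\<close> has a constant that involves
  \<open>c\<^sub>3\<close>. In the two regimes whose constant must be free of \<open>c\<^sub>3\<close>, the inequality
  \<open>2 * \<tau> > 1 - 2 * \<eta> \<ge> \<gamma>\<^sub>3 * \<eta>\<close> is strict, so that any constant is absorbed for large \<open>n\<close>. If
  \<open>\<tau> \<le> 0\<close>, the claim is trivial: the true model is nonempty, so overselection requires \<open>p \<ge> 2\<close>, and then
  \<open>p * exp (- C * n powr (2 * \<tau>)) \<ge> 1\<close> for every \<open>C \<le> ln 2\<close>.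
\<close>

section \<open>Quadratic forms in varying dimension\<close>

text \<open>
  The dimension varies with the sample size, so vectors and matrices are functions on \<open>nat\<close> and
  \<open>r\<close> is an explicit argument.
\<close>

definition quad_form :: "nat \<Rightarrow> (nat \<Rightarrow> nat \<Rightarrow> real) \<Rightarrow> (nat \<Rightarrow> real) \<Rightarrow> real" where
  "quad_form r A v = (\<Sum>i<r. v i * (\<Sum>j<r. A i j * v j))"

text \<open>
  The Rayleigh quotient attains its minimum because the unit sphere is compact. As a set of functions
  vanishing from \<open>r\<close> on, the sphere is a closed subset of a product of compact intervals, so Tychonoff's
  theorem applies.
\<close>

lemma quad_form_minimizer:
  assumes "r > 0"
  obtains v where "(\<Sum>i<r. (v i)\<^sup>2) = 1" "\<And>w. quad_form r A v * (\<Sum>i<r. (w i)\<^sup>2) \<le> quad_form r A w"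
proof -
  define K :: "(nat \<Rightarrow> real) set" where "K = (\<Pi>\<^sub>E i\<in>UNIV. if i < r then {-1..1} else {0})"
  define T where "T = K \<inter> {v. (\<Sum>i<r. (v i)\<^sup>2) = 1}"
  have coord: "continuous_on S (\<lambda>v. v i)" for S :: "(nat \<Rightarrow> real) set" and i
    by (rule continuous_on_subset[OF continuous_on_product_coordinates subset_UNIV])
  have "compactin (product_topology (\<lambda>_. euclidean) UNIV) K"
    unfolding K_def compactin_PiE by auto
  then have "compact K"
    by (simp add: euclidean_product_topology compactin_euclidean_iff)
  moreover have "closed {v. (\<Sum>i<r. ((v :: nat \<Rightarrow> real) i)\<^sup>2) = 1}"
    by (intro closed_Collect_eq continuous_on_sum continuous_on_power coord continuous_on_const)
  ultimately have T: "compact T"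
    unfolding T_def by (rule compact_Int_closed)
  have "(\<lambda>i. if i = 0 then 1 else 0) \<in> T"
    using assms by (auto simp: T_def K_def if_distrib[of "\<lambda>x. x\<^sup>2"] cong: if_cong)
  then have "T \<noteq> {}" by blast
  moreover have "continuous_on T (quad_form r A)"
    unfolding quad_form_def
    by (intro continuous_on_sum continuous_on_mult coord continuous_on_const)
  ultimately obtain v where v: "v \<in> T" "\<And>w. w \<in> T \<Longrightarrow> quad_form r A v \<le> quad_form r A w"
    using continuous_attains_inf[OF T] by blast
  have "quad_form r A v * (\<Sum>i<r. (w i)\<^sup>2) \<le> quad_form r A w" for w
  proof (cases "(\<Sum>i<r. (w i)\<^sup>2) = 0")
    case True
    then have "w i = 0" if "i < r" for i
      using that by (simp add: sum_nonneg_eq_0_iff)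
    then show ?thesis using True by (simp add: quad_form_def)
  next
    case False
    define N where "N = (\<Sum>i<r. (w i)\<^sup>2)"
    have N: "N > 0" using False sum_nonneg[of "{..<r}" "\<lambda>i. (w i)\<^sup>2"] by (auto simp: N_def less_le)
    define u where "u i = (if i < r then w i / sqrt N else 0)" for i
    have u2: "(u i)\<^sup>2 = (w i)\<^sup>2 / N" if "i < r" for i
      using that N by (simp add: u_def power_divide)
    have s1: "(\<Sum>i<r. (u i)\<^sup>2) = 1"
      using N by (simp add: u2 sum_divide_distrib[symmetric]) (simp add: N_def)
    have "\<bar>u i\<bar> \<le> 1" if "i < r" for i
    proof -
      have "(u i)\<^sup>2 \<le> (\<Sum>i<r. (u i)\<^sup>2)"
        using that by (intro member_le_sum) auto
      then show ?thesis using s1 by (simp add: abs_square_le_1)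
    qed
    moreover have "u i = 0" if "\<not> i < r" for i
      using that by (simp add: u_def)
    ultimately have "u i \<in> (if i < r then {-1..1} else {0})" for i
      by (simp add: abs_le_iff minus_le_iff)
    then have "u \<in> T"
      using s1 by (auto simp: T_def K_def)
    then have "quad_form r A v \<le> quad_form r A u" by (rule v)
    also have "quad_form r A u = quad_form r A w / N"
    proof -
      have "(\<Sum>j<r. A i j * u j) = (\<Sum>j<r. A i j * w j) / sqrt N" for i
        by (simp add: u_def sum_divide_distrib)
      then have "quad_form r A u = (\<Sum>i<r. w i * (\<Sum>j<r. A i j * w j) / (sqrt N * sqrt N))"
        unfolding quad_form_def by (intro sum.cong refl) (simp add: u_def)
      also have "\<dots> = quad_form r A w / N"
        unfolding quad_form_def sum_divide_distrib using N by simp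
      finally show ?thesis .
    qed
    finally show ?thesis using N by (simp add: field_simps N_def)
  qed
  with v show ?thesis by (intro that) (auto simp: T_def)
qed

lemma quad_form_add_scaled:
  assumes sym: "\<And>i j. i < r \<Longrightarrow> j < r \<Longrightarrow> A i j = A j i"
  shows "quad_form r A (\<lambda>i. v i + t * z i) =
     quad_form r A v + 2 * t * (\<Sum>i<r. z i * (\<Sum>j<r. A i j * v j)) + t\<^sup>2 * quad_form r A z"
proof -
  have *: "(\<Sum>i<r. v i * (\<Sum>j<r. A i j * z j)) = (\<Sum>i<r. z i * (\<Sum>j<r. A i j * v j))"
    unfolding sum_distrib_left
    by (subst sum.swap, intro sum.cong refl) (use sym in \<open>auto\<close>)
  have "quad_form r A (\<lambda>i. v i + t * z i) = (\<Sum>i<r. v i * (\<Sum>j<r. A i j * v j) +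
     t * (v i * (\<Sum>j<r. A i j * z j)) + t * (z i * (\<Sum>j<r. A i j * v j)) + t\<^sup>2 * (z i * (\<Sum>j<r. A i j * z j)))"
    unfolding quad_form_def
    by (intro sum.cong refl) (simp add: algebra_simps sum.distrib sum_distrib_left power2_eq_square)
  then show ?thesis
    by (simp add: sum.distrib sum_distrib_left[symmetric] * quad_form_def)
qed

text \<open>
  First-order condition at the minimum: moving from \<open>v\<close> in the direction \<open>z\<close> of the residual
  \<open>A v - \<mu> v\<close> changes the excess of the quadratic form over \<open>\<mu>\<close> times the squared norm by
  \<open>2 t |z|\<^sup>2 + O(t\<^sup>2)\<close>. Nonnegativity for small negative \<open>t\<close> forces \<open>z = 0\<close>.
\<close>

lemma quad_form_minimizer_eigenvector:
  assumes sym: "\<And>i j. i < r \<Longrightarrow> j < r \<Longrightarrow> A i j = A j i"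
    and v: "(\<Sum>i<r. (v i)\<^sup>2) = 1"
    and min: "\<And>w. quad_form r A v * (\<Sum>i<r. (w i)\<^sup>2) \<le> quad_form r A w"
    and i: "i < r"
  shows "(\<Sum>j<r. A i j * v j) = quad_form r A v * v i"
proof -
  define \<mu> where "\<mu> = quad_form r A v"
  define z where "z i = (\<Sum>j<r. A i j * v j) - \<mu> * v i" for i
  define a where "a = (\<Sum>i<r. (z i)\<^sup>2)"
  define b where "b = quad_form r A z - \<mu> * a"
  have nn: "0 \<le> 2 * t * a + t\<^sup>2 * b" for t
  proof -
    have 1: "(\<Sum>i<r. (v i + t * z i)\<^sup>2) = 1 + 2 * t * (\<Sum>i<r. z i * v i) + t\<^sup>2 * a"
      using v by (simp add: power2_sum sum.distrib a_def sum_distrib_left power_mult_distrib algebra_simps)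
    have 2: "a = (\<Sum>i<r. z i * (\<Sum>j<r. A i j * v j)) - \<mu> * (\<Sum>i<r. z i * v i)"
      unfolding a_def sum_distrib_left[of \<mu>] sum_subtractf[symmetric]
      by (intro sum.cong refl) (simp add: z_def power2_eq_square algebra_simps)
    have "\<mu> * (\<Sum>i<r. (v i + t * z i)\<^sup>2) \<le> quad_form r A (\<lambda>i. v i + t * z i)"
      unfolding \<mu>_def by (rule min)
    moreover have "quad_form r A (\<lambda>i. v i + t * z i) =
        \<mu> + 2 * t * (a + \<mu> * (\<Sum>i<r. z i * v i)) + t\<^sup>2 * quad_form r A z"
      using quad_form_add_scaled[where v=v and t=t and z=z, OF sym] 2 by (simp add: \<mu>_def)
    ultimately have "\<mu> * (1 + 2 * t * (\<Sum>i<r. z i * v i) + t\<^sup>2 * a) \<le>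
        \<mu> + 2 * t * (a + \<mu> * (\<Sum>i<r. z i * v i)) + t\<^sup>2 * quad_form r A z"
      unfolding 1 by linarith
    then show ?thesis
      unfolding b_def by (simp only: algebra_simps)
  qed
  have "a \<le> 0"
  proof (rule ccontr)
    assume "\<not> a \<le> 0"
    then have a: "a > 0" by simp
    \<comment> \<open>The denominator makes the linear term dominate the quadratic one.\<close>
    define t where "t = - a / (\<bar>b\<bar> + 1) "
    define q where "q = \<bar>b\<bar> + 1"
    have q: "q > 0" "b \<le> q" by (auto simp: q_def)
    have "t\<^sup>2 * b \<le> t\<^sup>2 * q" using q by (intro mult_left_mono) auto
    also have "t\<^sup>2 * q = a\<^sup>2 / q" using q by (simp add: t_def q_def[symmetric] power2_eq_square)
    finally have "0 \<le> 2 * t * a + a\<^sup>2 / q" using nn[of t] by linarith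
    also have "2 * t * a + a\<^sup>2 / q = - (a\<^sup>2 / q)" by (simp add: t_def q_def[symmetric] power2_eq_square)
    finally have "a\<^sup>2 / q \<le> 0" by simp
    moreover have "a\<^sup>2 / q > 0" using a q by (intro divide_pos_pos) auto
    ultimately show False by simp
  qed
  then have "z i = 0"
    using i sum_nonneg_eq_0_iff[of "{..<r}" "\<lambda>i. (z i)\<^sup>2"] sum_nonneg[of "{..<r}" "\<lambda>i. (z i)\<^sup>2"]
    unfolding a_def by auto
  then show ?thesis by (simp add: z_def \<mu>_def)
qed

text \<open>
  The minimum of the Rayleigh quotient is an eigenvalue, hence at least the smallest one.
\<close>

lemma lambda_min_le_quad_form:
  fixes A :: "nat \<Rightarrow> nat \<Rightarrow> real"
  assumes r: "r > 0" and sym: "\<And>i j. i < r \<Longrightarrow> j < r \<Longrightarrow> A i j = A j i"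
  shows "lambda_min (Matrix.mat r r (\<lambda>(i, j). A i j)) * (\<Sum>i<r. (w i)\<^sup>2) \<le> quad_form r A w"
proof -
  let ?M = "Matrix.mat r r (\<lambda>(i, j). A i j)"
  obtain v where v: "(\<Sum>i<r. (v i)\<^sup>2) = 1"
    and min: "\<And>w. quad_form r A v * (\<Sum>i<r. (w i)\<^sup>2) \<le> quad_form r A w"
    using quad_form_minimizer[OF r] by blast
  have "eigenvector ?M (Matrix.vec r v) (quad_form r A v)"
    unfolding eigenvector_def
  proof (intro conjI)
    show "Matrix.vec r v \<noteq> 0\<^sub>v (dim_row ?M)"
    proof
      assume "Matrix.vec r v = 0\<^sub>v (dim_row ?M)"
      then have "v i = 0" if "i < r" for i
        using that by (metis dim_row_mat(1) index_vec index_zero_vec(1))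
      with v show False by simp
    qed
    show "?M *\<^sub>v Matrix.vec r v = quad_form r A v \<cdot>\<^sub>v Matrix.vec r v"
      by (intro eq_vecI) (auto simp: scalar_prod_def quad_form_minimizer_eigenvector[OF sym v min] atLeast0LessThan)
  qed auto
  then have "eigenvalue ?M (quad_form r A v)" by (auto simp: eigenvalue_def)
  moreover have "finite {k. eigenvalue ?M k}"
    using card_finite_spectrum(1)[of ?M r] by (simp add: spectrum_def)
  ultimately have "lambda_min ?M \<le> quad_form r A v"
    unfolding lambda_min_def by (intro Min_le) auto
  then have "lambda_min ?M * (\<Sum>i<r. (w i)\<^sup>2) \<le> quad_form r A v * (\<Sum>i<r. (w i)\<^sup>2)"
    by (intro mult_right_mono sum_nonneg) auto
  with min[of w] show ?thesis by linarith
qed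

text \<open>
  A coercive matrix is injective, hence invertible, even if it is not symmetric. The norm bound follows
  by testing the system with its own solution: \<open>0 \<le> |x - c b|\<^sup>2\<close> together with coercivity at \<open>b\<close>.
\<close>

lemma coercive_solvable:
  fixes A :: "nat \<Rightarrow> nat \<Rightarrow> real"
  assumes c: "c > 0" and coercive: "\<And>v. c * (\<Sum>i<r. (v i)\<^sup>2) \<le> quad_form r A v"
  obtains b where "\<And>i. i < r \<Longrightarrow> (\<Sum>j<r. A i j * b j) = x i"
    "c\<^sup>2 * (\<Sum>i<r. (b i)\<^sup>2) \<le> (\<Sum>i<r. (x i)\<^sup>2)"
proof -
  let ?M = "Matrix.mat r r (\<lambda>(i, j). A i j)"
  have M: "?M \<in> carrier_mat r r" by simp
  have "Determinant.det ?M \<noteq> 0"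
  proof
    assume "Determinant.det ?M = 0"
    then obtain v where v: "v \<in> carrier_vec r" "v \<noteq> 0\<^sub>v r" "?M *\<^sub>v v = 0\<^sub>v r"
      using det_0_iff_vec_prod_zero_field[OF M] by auto
    have "(\<Sum>j<r. A i j * vec_index v j) = 0" if "i < r" for i
    proof -
      have "(\<Sum>j<r. A i j * vec_index v j) = vec_index (?M *\<^sub>v v) i"
        using that v(1) by (auto simp: scalar_prod_def atLeast0LessThan intro!: sum.cong)
      then show ?thesis using v(3) that by simp
    qed
    then have "quad_form r A (vec_index v) = 0" by (simp add: quad_form_def)
    with coercive[of "vec_index v"] c have "(\<Sum>i<r. (vec_index v i)\<^sup>2) \<le> 0"
      by (simp add: mult_le_0_iff)
    then have "vec_index v i = 0" if "i < r" for i
      using that sum_nonneg_eq_0_iff[of "{..<r}" "\<lambda>i. (vec_index v i)\<^sup>2"] sum_nonneg[of "{..<r}" "\<lambda>i. (vec_index v i)\<^sup>2"]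
      by auto
    then have "v = 0\<^sub>v r" using v(1) by (intro eq_vecI) auto
    with v(2) show False by simp
  qed
  have right_inverse: "\<exists>B\<in>carrier_mat r r. N * B = 1\<^sub>m r"
    if N: "N \<in> carrier_mat r r" "Determinant.det N \<noteq> 0" for N :: "real Matrix.mat"
    using det_non_zero_imp_unit[OF N, of "()"] unfolding Units_def ring_mat_def by auto
  then obtain B where B: "B \<in> carrier_mat r r" "?M * B = 1\<^sub>m r"
    using M \<open>Determinant.det ?M \<noteq> 0\<close> by blast
  define b where "b = vec_index (B *\<^sub>v Matrix.vec r x)"
  have *: "?M *\<^sub>v (B *\<^sub>v Matrix.vec r x) = Matrix.vec r x"
    using assoc_mult_mat_vec[OF M B(1), of "Matrix.vec r x"] unfolding B(2) by simp
  then have sol: "(\<Sum>j<r. A i j * b j) = x i" if "i < r" for i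
  proof -
    have "(\<Sum>j<r. A i j * b j) = vec_index (?M *\<^sub>v (B *\<^sub>v Matrix.vec r x)) i"
      using that B(1) unfolding b_def
      by (subst index_mult_mat_vec) (auto simp: scalar_prod_def atLeast0LessThan intro!: sum.cong)
    with * that show ?thesis by simp
  qed
  define N where "N = (\<Sum>i<r. (b i)\<^sup>2)"
  have "0 \<le> (\<Sum>i<r. (x i - c * b i)\<^sup>2)" by (intro sum_nonneg) auto
  also have "\<dots> = (\<Sum>i<r. (x i)\<^sup>2) + c\<^sup>2 * N - 2 * c * (\<Sum>i<r. b i * x i)"
    by (simp add: N_def power2_diff sum.distrib sum_subtractf sum_distrib_left power_mult_distrib algebra_simps)
  also have "(\<Sum>i<r. b i * x i) = quad_form r A b"
    by (simp add: quad_form_def sol)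
  also have "(\<Sum>i<r. (x i)\<^sup>2) + c\<^sup>2 * N - 2 * c * quad_form r A b \<le> (\<Sum>i<r. (x i)\<^sup>2) + c\<^sup>2 * N - 2 * c * (c * N)"
    using coercive[of b] c by (simp add: N_def)
  finally have "c\<^sup>2 * N \<le> (\<Sum>i<r. (x i)\<^sup>2)" by (simp add: power2_eq_square algebra_simps)
  with sol show ?thesis by (intro that) (auto simp: N_def)
qed

section \<open>Feasible empirical likelihood weights\<close>

lemma abs_inner_le:
  fixes u v :: "nat \<Rightarrow> real"
  shows "\<bar>\<Sum>k<r. u k * v k\<bar> \<le> sqrt (\<Sum>k<r. (u k)\<^sup>2) * sqrt (\<Sum>k<r. (v k)\<^sup>2)"
proof -
  have "sqrt ((\<Sum>k<r. u k * v k)\<^sup>2) \<le> sqrt ((\<Sum>k<r. (u k)\<^sup>2) * (\<Sum>k<r. (v k)\<^sup>2))"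
    by (intro real_sqrt_le_mono Cauchy_Schwarz_ineq_sum)
  then show ?thesis by (simp add: real_sqrt_mult)
qed

text \<open>
  The whole vector is replaced by \<open>0\<close> if it is long, instead of being rescaled. Therefore the products
  of a vector with its clipped version are the products of the clipped version with itself.
\<close>

definition clip :: "nat \<Rightarrow> real \<Rightarrow> (nat \<Rightarrow> real) \<Rightarrow> nat \<Rightarrow> real" where
  "clip r L x k = (if (\<Sum>l<r. (x l)\<^sup>2) \<le> L\<^sup>2 then x k else 0)"

lemma abs_inner_clip_le:
  assumes "L \<ge> 0"
  shows "\<bar>\<Sum>k<r. v k * clip r L x k\<bar> \<le> sqrt (\<Sum>k<r. (v k)\<^sup>2) * L"
proof -
  have "sqrt (\<Sum>k<r. (clip r L x k)\<^sup>2) \<le> sqrt (L\<^sup>2)"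
    by (intro real_sqrt_le_mono, cases "(\<Sum>l<r. (x l)\<^sup>2) \<le> L\<^sup>2") (simp_all add: clip_def)
  then have "sqrt (\<Sum>k<r. (v k)\<^sup>2) * sqrt (\<Sum>k<r. (clip r L x k)\<^sup>2) \<le> sqrt (\<Sum>k<r. (v k)\<^sup>2) * L"
    using assms by (intro mult_left_mono) (auto intro: sum_nonneg)
  with abs_inner_le[where u=v and v="clip r L x" and r=r] show ?thesis by linarith
qed

lemma inner_mult_inner_clip:
  "(\<Sum>k<r. v k * x k) * (\<Sum>k<r. v k * clip r L x k) = (\<Sum>k<r. v k * clip r L x k)\<^sup>2"
  by (cases "(\<Sum>l<r. (x l)\<^sup>2) \<le> L\<^sup>2") (simp_all add: clip_def power2_eq_square)

text \<open>
  With \<open>y\<^sub>i\<close> the clipped vectors and \<open>\<mu>\<close> their mean, the weights \<open>n w\<^sub>i = 1 - b \<bullet> (y\<^sub>i - \<mu>)\<close> sum to one, and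
  they annihilate the \<open>x\<^sub>i\<close> iff \<open>b\<close> solves the system with matrix \<open>mean (x y\<^sup>T) - m \<mu>\<^sup>T\<close> and right-hand side
  \<open>m\<close>. By the choice of clipping the first part is the Gram matrix of the \<open>y\<^sub>i\<close>, and the second part has
  norm at most \<open>L |m|\<close>, so the matrix is coercive if \<open>L |m|\<close> is small compared with \<open>c\<close>. Then \<open>b\<close> has norm
  of order \<open>|m| / c\<close>, the tilts are at most \<open>1/2\<close>, and since they sum to zero the log-likelihood ratio is
  of second order in them.
\<close>

lemma tilted_weights:
  fixes x :: "nat \<Rightarrow> nat \<Rightarrow> real" and n :: nat
  defines "m \<equiv> (\<lambda>k. (\<Sum>i=1..n. x i k) / real n)"
  assumes n: "n > 0" and L: "L > 0" and c: "c > 0"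
    and coercive: "\<And>v. c * (\<Sum>k<r. (v k)\<^sup>2) \<le> (\<Sum>i=1..n. (\<Sum>k<r. v k * clip r L (x i) k)\<^sup>2) / real n"
    and small: "8 * L * sqrt (\<Sum>k<r. (m k)\<^sup>2) \<le> c"
  obtains w where "\<And>i. i \<in> {1..n} \<Longrightarrow> w i > 0" "(\<Sum>i=1..n. w i) = 1"
    "\<And>k. k < r \<Longrightarrow> (\<Sum>i=1..n. w i * x i k) = 0"
    "- 2 * (\<Sum>i=1..n. ln (real n * w i)) \<le> 64 * real n * L\<^sup>2 / c\<^sup>2 * (\<Sum>k<r. (m k)\<^sup>2)"
proof -
  define y where "y i = clip r L (x i)" for i
  define \<mu> where "\<mu> k = (\<Sum>i=1..n. y i k) / real n" for k
  define A where "A k l = (\<Sum>i=1..n. x i k * y i l) / real n - m k * \<mu> l" for k l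
  define nm where "nm v = sqrt (\<Sum>k<r. (v k)\<^sup>2)" for v :: "nat \<Rightarrow> real"
  have nm0: "nm v \<ge> 0" for v unfolding nm_def by (auto intro: sum_nonneg)
  have nm2: "(nm v)\<^sup>2 = (\<Sum>k<r. (v k)\<^sup>2)" for v unfolding nm_def by (auto intro: sum_nonneg)
  have inner_y: "\<bar>\<Sum>k<r. v k * y i k\<bar> \<le> nm v * L" for v i
    unfolding y_def nm_def using L by (intro abs_inner_clip_le) auto
  have inner_\<mu>: "\<bar>\<Sum>k<r. v k * \<mu> k\<bar> \<le> nm v * L" for v
  proof -
    have "(\<Sum>k<r. v k * \<mu> k) = (\<Sum>i=1..n. \<Sum>k<r. v k * y i k) / real n"
      unfolding \<mu>_def by (subst sum.swap) (simp add: sum_distrib_left sum_divide_distrib)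
    also have "\<bar>\<dots>\<bar> \<le> (\<Sum>i=1..n. nm v * L) / real n"
      using n by (simp only: abs_divide abs_of_nat)
        (intro divide_right_mono order.trans[OF sum_abs] sum_mono inner_y, simp)
    also have "\<dots> = nm v * L" using n by simp
    finally show ?thesis .
  qed
  have quad: "quad_form r A v =
      (\<Sum>i=1..n. (\<Sum>k<r. v k * y i k)\<^sup>2) / real n - (\<Sum>k<r. v k * m k) * (\<Sum>k<r. v k * \<mu> k)" for v
  proof -
    have "quad_form r A v = (\<Sum>k<r. v k * (\<Sum>l<r. (\<Sum>i=1..n. x i k * y i l) / real n * v l))
        - (\<Sum>k<r. v k * (\<Sum>l<r. m k * \<mu> l * v l))"
      unfolding quad_form_def A_def by (simp add: left_diff_distrib sum_subtractf right_diff_distrib)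
    also have "(\<Sum>k<r. v k * (\<Sum>l<r. m k * \<mu> l * v l)) = (\<Sum>k<r. v k * m k) * (\<Sum>k<r. v k * \<mu> k)"
      unfolding sum_product by (intro sum.cong refl) (simp add: sum_distrib_left mult_ac)
    also have "(\<Sum>k<r. v k * (\<Sum>l<r. (\<Sum>i=1..n. x i k * y i l) / real n * v l)) =
        (\<Sum>k<r. \<Sum>l<r. \<Sum>i=1..n. (v k * x i k) * (v l * y i l)) / real n"
      by (simp add: sum_distrib_left sum_distrib_right sum_divide_distrib mult_ac)
    also have "(\<Sum>k<r. \<Sum>l<r. \<Sum>i=1..n. (v k * x i k) * (v l * y i l)) =
        (\<Sum>i=1..n. (\<Sum>k<r. v k * x i k) * (\<Sum>k<r. v k * y i k))"
    proof -
      have "(\<Sum>k<r. \<Sum>l<r. \<Sum>i=1..n. (v k * x i k) * (v l * y i l)) =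
          (\<Sum>k<r. \<Sum>i=1..n. \<Sum>l<r. (v k * x i k) * (v l * y i l))"
        by (intro sum.cong refl sum.swap)
      also have "\<dots> = (\<Sum>i=1..n. \<Sum>k<r. \<Sum>l<r. (v k * x i k) * (v l * y i l))"
        by (rule sum.swap)
      finally show ?thesis unfolding sum_product .
    qed
    also have "\<dots> = (\<Sum>i=1..n. (\<Sum>k<r. v k * y i k)\<^sup>2)"
      unfolding y_def by (simp only: inner_mult_inner_clip)
    finally show ?thesis .
  qed
  have "c / 2 * (\<Sum>k<r. (v k)\<^sup>2) \<le> quad_form r A v" for v
  proof -
    have "\<bar>(\<Sum>k<r. v k * m k) * (\<Sum>k<r. v k * \<mu> k)\<bar> \<le> (nm v * nm m) * (nm v * L)"
      unfolding abs_mult using abs_inner_le[where u=v and v=m and r=r] inner_\<mu>[of v]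
      by (intro mult_mono) (auto simp: nm_def[symmetric] nm0)
    also have "\<dots> = (L * nm m) * (nm v)\<^sup>2" by (simp add: power2_eq_square)
    also have "\<dots> \<le> c / 2 * (nm v)\<^sup>2"
      using small c by (intro mult_right_mono) (auto simp: nm_def[symmetric])
    finally show ?thesis
      using coercive[of v] unfolding quad nm2 y_def abs_le_iff by linarith
  qed
  then obtain b where b: "\<And>k. k < r \<Longrightarrow> (\<Sum>l<r. A k l * b l) = m k"
    and bm: "(c / 2)\<^sup>2 * (\<Sum>k<r. (b k)\<^sup>2) \<le> (\<Sum>k<r. (m k)\<^sup>2)"
    using coercive_solvable[of "c / 2" r A m] c by auto
  have nb: "c * nm b \<le> 2 * nm m"
  proof (rule power2_le_imp_le)
    show "(c * nm b)\<^sup>2 \<le> (2 * nm m)\<^sup>2"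
      using bm by (simp add: power_mult_distrib nm2 power_divide)
  qed (use nm0 in simp)
  define t where "t i = (\<Sum>l<r. b l * y i l) - (\<Sum>l<r. b l * \<mu> l)" for i
  define w where "w i = (1 - t i) / real n" for i
  have t_bound: "\<bar>t i\<bar> \<le> 4 * L / c * nm m" for i
  proof -
    have "\<bar>t i\<bar> \<le> nm b * L + nm b * L"
      unfolding t_def using inner_y[of b i] inner_\<mu>[of b]
      by (intro order.trans[OF abs_triangle_ineq4 add_mono])
    also have "\<dots> = 2 * L * nm b" by simp
    also have "\<dots> \<le> 2 * L * (2 * nm m / c)"
      using nb L c by (intro mult_left_mono) (auto simp: field_simps)
    finally show ?thesis by simp
  qed
  have t_half: "\<bar>t i\<bar> \<le> 1/2" for i
  proof -
    have "4 * L / c * nm m \<le> 1/2"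
      using small c by (simp add: nm_def[symmetric] field_simps)
    with t_bound[of i] show ?thesis by linarith
  qed
  have sum_t: "(\<Sum>i=1..n. t i) = 0"
  proof -
    have "(\<Sum>i=1..n. \<Sum>l<r. b l * y i l) = (\<Sum>l<r. b l * (\<Sum>i=1..n. y i l))"
      by (subst sum.swap) (simp add: sum_distrib_left)
    also have "\<dots> = (\<Sum>l<r. real n * (b l * \<mu> l))"
      using n by (intro sum.cong refl) (simp add: \<mu>_def)
    finally have "(\<Sum>i=1..n. \<Sum>l<r. b l * y i l) = real n * (\<Sum>l<r. b l * \<mu> l)"
      by (simp add: sum_distrib_left)
    then show ?thesis by (simp add: t_def sum_subtractf)
  qed
  show ?thesis
  proof
    show "w i > 0" if "i \<in> {1..n}" for i
      using t_half[of i] n by (auto simp: w_def)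
    show "(\<Sum>i=1..n. w i) = 1"
      using n sum_t by (simp add: w_def sum_divide_distrib[symmetric] sum_subtractf)
    show "(\<Sum>i=1..n. w i * x i k) = 0" if "k < r" for k
    proof -
      have "(\<Sum>i=1..n. t i * x i k) / real n = (\<Sum>l<r. A k l * b l)"
      proof -
        define M where "M = (\<Sum>l<r. b l * \<mu> l)"
        have "t i * x i k = (\<Sum>l<r. b l * (x i k * y i l)) - x i k * M" for i
        proof -
          have "(\<Sum>l<r. b l * y i l) * x i k = (\<Sum>l<r. b l * (x i k * y i l))"
            unfolding sum_distrib_right by (simp only: mult_ac)
          then show ?thesis by (simp add: t_def M_def[symmetric] left_diff_distrib)
        qed
        then have "(\<Sum>i=1..n. t i * x i k) = (\<Sum>i=1..n. \<Sum>l<r. b l * (x i k * y i l)) - (\<Sum>i=1..n. x i k) * M"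
          by (simp only: sum_subtractf sum_distrib_right)
        also have "(\<Sum>i=1..n. x i k) = real n * m k" using n by (simp add: m_def)
        also have "(\<Sum>i=1..n. \<Sum>l<r. b l * (x i k * y i l)) = (\<Sum>l<r. b l * (\<Sum>i=1..n. x i k * y i l))"
          by (subst sum.swap) (simp add: sum_distrib_left)
        also have "(\<Sum>l<r. b l * (\<Sum>i=1..n. x i k * y i l)) - real n * m k * M
            = (\<Sum>l<r. real n * (A k l * b l))"
          unfolding M_def sum_distrib_left[of "real n * m k"] sum_subtractf[symmetric] using n
          by (intro sum.cong refl) (simp add: A_def field_simps)
        finally show ?thesis using n by (simp add: sum_distrib_left[symmetric])
      qed
      then have "(\<Sum>i=1..n. t i * x i k) / real n = m k" using b[OF that] by simp
      then show ?thesis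
        by (simp add: w_def m_def sum_divide_distrib[symmetric] left_diff_distrib sum_subtractf diff_divide_distrib) auto
    qed
    have "- ln (real n * w i) \<le> t i + 2 * (t i)\<^sup>2" for i
    proof -
      have "real n * w i = 1 + - t i" using n by (simp add: w_def)
      moreover have "\<bar>ln (1 + - t i) - - t i\<bar> \<le> 2 * (- t i)\<^sup>2"
        by (rule abs_ln_one_plus_x_minus_x_bound) (use t_half in simp)
      ultimately show ?thesis unfolding abs_le_iff by simp
    qed
    then have "(\<Sum>i=1..n. - ln (real n * w i)) \<le> (\<Sum>i=1..n. t i + 2 * (t i)\<^sup>2)"
      by (intro sum_mono) auto
    also have "\<dots> = 2 * (\<Sum>i=1..n. (t i)\<^sup>2)"
      using sum_t by (simp add: sum.distrib sum_distrib_left)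
    also have "(\<Sum>i=1..n. (t i)\<^sup>2) \<le> (\<Sum>i=1..n. (4 * L / c * nm m)\<^sup>2)"
      by (intro sum_mono) (metis t_bound abs_ge_zero power_mono power2_abs)
    finally have "- (\<Sum>i=1..n. ln (real n * w i)) \<le> 2 * (real n * (4 * L / c * nm m)\<^sup>2)"
      by (simp add: sum_negf)
    also have "\<dots> = 32 * real n * L\<^sup>2 / c\<^sup>2 * (\<Sum>k<r. (m k)\<^sup>2)"
      by (simp add: power_mult_distrib power_divide nm2)
    finally show "- 2 * (\<Sum>i=1..n. ln (real n * w i)) \<le> 64 * real n * L\<^sup>2 / c\<^sup>2 * (\<Sum>k<r. (m k)\<^sup>2)"
      by simp
  qed
qed

text \<open>
  The supremum over feasible weights is at least the value of one feasible positive weight vector; it is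
  finite because a product of weights is at most \<open>1\<close>.
\<close>

lemma marg_ELR_le:
  assumes n: "n > 0" and pos: "\<And>i. i \<in> {1..n} \<Longrightarrow> w i > 0" and one: "(\<Sum>i=1..n. w i) = 1"
    and feas: "\<And>k. k < card (marg_comps m j) \<Longrightarrow>
       (\<Sum>i=1..n. w i * vec_index (marg_est m j (sample m i \<omega>) 0) k) = 0"
  shows "marg_ELR n m j \<omega> \<le> ereal (- 2 * (\<Sum>i=1..n. ln (real n * w i)))"
proof -
  let ?S = "{\<Prod>i\<in>{1..n}. w i | w :: nat \<Rightarrow> real.
     (\<forall>i\<in>{1..n}. w i \<ge> 0) \<and> (\<Sum>i\<in>{1..n}. w i) = 1 \<and>
     (\<forall>k<card (marg_comps m j).
        (\<Sum>i\<in>{1..n}. w i * vec_index (marg_est m j (sample m i \<omega>) 0) k) = 0)}"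
  have "prod u {1..n} \<le> 1" if "\<forall>i\<in>{1..n}. u i \<ge> 0" "(\<Sum>i\<in>{1..n}. u i) = 1" for u :: "nat \<Rightarrow> real"
  proof (rule prod_le_1)
    fix i assume i: "i \<in> {1..n}"
    have "u i \<le> sum u {1..n}" using that i by (intro member_le_sum) auto
    then show "0 \<le> u i \<and> u i \<le> 1" using that i by auto
  qed
  note le_1 = this
  have "bdd_above (insert 0 ?S)"
  proof (rule bdd_aboveI)
    fix z assume "z \<in> insert 0 ?S"
    then show "z \<le> 1"
    proof (elim insertE CollectE exE conjE)
      fix u assume "z = prod u {1..n}" "\<forall>i\<in>{1..n}. u i \<ge> 0" "(\<Sum>i\<in>{1..n}. u i) = 1"
      then show ?thesis using le_1[of u] by (simp only:)
    qed simp
  qed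
  moreover have "prod w {1..n} \<in> ?S" 
    by (intro CollectI exI[of _ w] conjI ballI allI impI refl one feas less_imp_le pos)
  ultimately have le: "prod w {1..n} \<le> marg_EL n m j \<omega>"
    unfolding marg_EL_def by (intro cSup_upper insertI2)
  have p: "prod w {1..n} > 0" using pos by (intro prod_pos) auto
  have "ln (prod w {1..n}) \<le> ln (marg_EL n m j \<omega>)" using le p by simp
  moreover have "ln (prod w {1..n}) = (\<Sum>i=1..n. ln (w i))" 
    by (rule ln_prod[OF finite_atLeastAtMost]) (metis less_irrefl pos)
  moreover have "(\<Sum>i=1..n. ln (real n * w i)) = real n * ln (real n) + (\<Sum>i=1..n. ln (w i))"
  proof -
    have "(\<Sum>i=1..n. ln (real n * w i)) = (\<Sum>i=1..n. ln (real n) + ln (w i))"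
      by (intro sum.cong refl ln_mult_pos pos) (use n in simp)
    then show ?thesis by (simp add: sum.distrib)
  qed
  ultimately show ?thesis using le p by (auto simp: marg_ELR_def)
qed

section \<open>Weibull tails and exponential inequalities\<close>

text \<open>
  A bound, depending only on the tail constants, for the \<open>q\<close>-th moment of a variable \<open>g \<ge> 0\<close> with
  \<open>P (g \<ge> u) \<le> K * exp (- a * u powr \<gamma>)\<close>. The term with index \<open>i\<close> accounts for \<open>g\<close> between \<open>i + 1\<close> and
  \<open>i + 2\<close>, the summand \<open>1\<close> for \<open>g < 1\<close>.
\<close>

definition weibull_moment :: "real \<Rightarrow> real \<Rightarrow> real \<Rightarrow> nat \<Rightarrow> real" where
  "weibull_moment K a \<gamma> q = 1 + (\<Sum>i. real (i + 2) ^ q * (K * exp (- a * real (i + 1) powr \<gamma>)))"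

lemma summable_weibull_moment:
  assumes "a > 0" "\<gamma> > 0"
  shows "summable (\<lambda>i. real (i + 2) ^ q * (K * exp (- a * real (i + 1) powr \<gamma>)))"
proof (rule summable_comparison_test_ev)
  have "(\<lambda>i. real (i + 2) ^ q * (K * exp (- a * real (i + 1) powr \<gamma>)) * real i ^ 2) \<longlonglongrightarrow> 0"
    using assms by real_asymp
  then have "\<forall>\<^sub>F i in sequentially. \<bar>real (i + 2) ^ q * (K * exp (- a * real (i + 1) powr \<gamma>)) * real i ^ 2\<bar> < 1"
    using order_tendstoD(2)[OF tendsto_rabs_zero] by fastforce
  then show "\<forall>\<^sub>F i in sequentially. norm (real (i + 2) ^ q * (K * exp (- a * real (i + 1) powr \<gamma>))) \<le> 1 / real i ^ 2"
    using eventually_gt_at_top[of 0]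
  proof eventually_elim
    case (elim i)
    then show ?case
      unfolding real_norm_def by (subst pos_le_divide_eq) (auto simp: abs_mult)
  qed
  show "summable (\<lambda>i. 1 / real i ^ 2)"
    using inverse_power_summable[of 2, where 'a = real] by (simp add: inverse_eq_divide)
qed

lemma weibull_series_nonneg:
  assumes "a > 0" "\<gamma> > 0" "K > 0"
  shows "0 \<le> (\<Sum>i. real (i + 2) ^ q * (K * exp (- a * real (i + 1) powr \<gamma>)))"
  using assms by (intro suminf_nonneg summable_weibull_moment) auto

lemma weibull_moment_ge_1:
  assumes "a > 0" "\<gamma> > 0" "K > 0"
  shows "weibull_moment K a \<gamma> q \<ge> 1"
  unfolding weibull_moment_def using weibull_series_nonneg[OF assms, of q] by simp

lemma (in prob_space) weibull_tail_moment:
  assumes g[measurable]: "g \<in> borel_measurable M" and nn: "\<And>z. z \<in> space M \<Longrightarrow> 0 \<le> g z"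
    and tail: "\<And>u. u > 0 \<Longrightarrow> prob {z \<in> space M. g z \<ge> u} \<le> K * exp (- a * u powr \<gamma>)"
    and pos: "a > 0" "\<gamma> > 0" "K > 0"
  shows "integrable M (\<lambda>z. g z ^ q)" "(\<integral>z. g z ^ q \<partial>M) \<le> weibull_moment K a \<gamma> q"
proof -
  define A where "A i = {z \<in> space M. g z \<ge> real (i + 1)}" for i :: nat
  have A[measurable]: "A i \<in> sets M" for i unfolding A_def by measurable
  have term_le: "h i \<le> (\<Sum>i. h i)" for h :: "nat \<Rightarrow> ennreal" and i
    using sum_le_suminf[of h "{i}"] by simp
  have ptw: "ennreal (g z ^ q) \<le> 1 + (\<Sum>i. ennreal (real (i + 2) ^ q) * indicator (A i) z)"
    if z: "z \<in> space M" for z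
  proof (cases "g z < 1")
    case True
    then have "ennreal (g z ^ q) \<le> 1" using nn[OF z] by (simp add: power_le_one)
    then show ?thesis by (rule order.trans) simp
  next
    case False
    define i where "i = nat \<lfloor>g z\<rfloor> - 1"
    have fl: "1 \<le> \<lfloor>g z\<rfloor>" using False by simp
    have i1: "real (i + 1) = of_int \<lfloor>g z\<rfloor>" using fl by (simp add: i_def of_nat_diff)
    then have "g z \<le> real (i + 2)" "z \<in> A i" using z by (auto simp: A_def) linarith+
    then have "ennreal (g z ^ q) \<le> ennreal (real (i + 2) ^ q) * indicator (A i) z"
      using nn[OF z] by (auto intro!: ennreal_leI power_mono)
    also have "\<dots> \<le> (\<Sum>i. ennreal (real (i + 2) ^ q) * indicator (A i) z)"
      by (rule term_le[of "\<lambda>i. ennreal (real (i + 2) ^ q) * indicator (A i) z"])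
    finally show ?thesis by (simp add: add_increasing)
  qed
  have "(\<integral>\<^sup>+z. ennreal (g z ^ q) \<partial>M) \<le> (\<integral>\<^sup>+z. 1 + (\<Sum>i. ennreal (real (i + 2) ^ q) * indicator (A i) z) \<partial>M)"
    by (intro nn_integral_mono ptw)
  also have "\<dots> = 1 + (\<Sum>i. ennreal (real (i + 2) ^ q) * emeasure M (A i))"
    by (simp add: nn_integral_add nn_integral_suminf nn_integral_cmult_indicator emeasure_space_1)
  also have "\<dots> \<le> 1 + (\<Sum>i. ennreal (real (i + 2) ^ q * (K * exp (- a * real (i + 1) powr \<gamma>))))"
  proof (intro add_left_mono suminf_le)
    fix i
    have "emeasure M (A i) \<le> ennreal (K * exp (- a * real (i + 1) powr \<gamma>))"
      unfolding emeasure_eq_measure A_def by (intro ennreal_leI tail) simp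
    then show "ennreal (real (i + 2) ^ q) * emeasure M (A i) \<le>
        ennreal (real (i + 2) ^ q * (K * exp (- a * real (i + 1) powr \<gamma>)))"
      using pos(3) by (subst ennreal_mult) (auto intro!: mult_left_mono)
  qed auto
  also have "(\<Sum>i. ennreal (real (i + 2) ^ q * (K * exp (- a * real (i + 1) powr \<gamma>)))) =
      ennreal (\<Sum>i. real (i + 2) ^ q * (K * exp (- a * real (i + 1) powr \<gamma>)))"
    using pos by (intro suminf_ennreal2 summable_weibull_moment) auto
  also have "1 + \<dots> = ennreal (weibull_moment K a \<gamma> q)"
    unfolding weibull_moment_def using weibull_series_nonneg[OF pos, of q]
    by (subst ennreal_plus) simp_all
  finally have le: "(\<integral>\<^sup>+z. ennreal (g z ^ q) \<partial>M) \<le> ennreal (weibull_moment K a \<gamma> q)" .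
  show "integrable M (\<lambda>z. g z ^ q)"
  proof (rule integrableI_bounded)
    have "(\<integral>\<^sup>+z. ennreal (norm (g z ^ q)) \<partial>M) = (\<integral>\<^sup>+z. ennreal (g z ^ q) \<partial>M)"
      using nn by (intro nn_integral_cong) simp
    with le show "(\<integral>\<^sup>+z. ennreal (norm (g z ^ q)) \<partial>M) < \<infinity>"
      by (auto intro: le_less_trans)
  qed measurable
  show "(\<integral>z. g z ^ q \<partial>M) \<le> weibull_moment K a \<gamma> q"
    using weibull_moment_ge_1[OF pos, of q] le by (intro integral_real_bounded) auto
qed

text \<open>
  For negative \<open>x = - y\<close> this follows from \<open>(1 - y + y\<^sup>2) * (1 + y) = 1 + y\<^sup>3 \<ge> 1\<close> and
  \<open>1 + y \<le> exp y\<close>.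
\<close>

lemma exp_le_quadratic:
  fixes x :: real
  assumes "\<bar>x\<bar> \<le> 1"
  shows "exp x \<le> 1 + x + x\<^sup>2"
proof (cases "x \<ge> 0")
  case True
  then show ?thesis using assms by (intro exp_bound) auto
next
  case False
  define y where "y = - x"
  have y: "0 < y" "y \<le> 1" using False assms by (auto simp: y_def)
  have "1 \<le> (1 - y + y\<^sup>2) * (1 + y)"
  proof -
    have "(1 - y + y\<^sup>2) * (1 + y) = 1 + y ^ 3"
      by (simp add: algebra_simps power2_eq_square power3_eq_cube)
    then show ?thesis using y by simp
  qed
  also have "\<dots> \<le> (1 - y + y\<^sup>2) * exp y"
    using y exp_ge_add_one_self[of y] by (intro mult_left_mono) auto
  finally have "exp (- y) \<le> 1 - y + y\<^sup>2" by (simp add: exp_minus field_simps)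
  then show ?thesis by (simp add: y_def)
qed

text \<open>
  The common law of the sample is a measure of its own, so that moments are integrals over the sample
  space \<open>D\<close> and do not refer to any particular observation.
\<close>

locale iid_sample = prob_space P for P :: "'a measure" +
  fixes D :: "'b measure" and Z :: "nat \<Rightarrow> 'a \<Rightarrow> 'b" and n :: nat
  assumes indep: "indep_vars (\<lambda>_. D) Z {1..n}"
    and distr_Z: "i \<in> {1..n} \<Longrightarrow> distr P D (Z i) = D"
    and n_pos: "n > 0"
begin

lemma Z_measurable: "i \<in> {1..n} \<Longrightarrow> Z i \<in> measurable P D"
  using indep by (simp add: indep_vars_def)

lemma prob_space_D: "prob_space D"
  using prob_space_distr[OF Z_measurable[of 1]] distr_Z[of 1] n_pos by simp

lemma integral_sample:
  fixes f :: "'b \<Rightarrow> real"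
  assumes "f \<in> borel_measurable D" "i \<in> {1..n}"
  shows "(\<integral>\<omega>. f (Z i \<omega>) \<partial>P) = (\<integral>z. f z \<partial>D)"
  using integral_distr[OF Z_measurable[OF assms(2)] assms(1)] distr_Z[OF assms(2)] by simp

lemma prob_sample:
  assumes "A \<in> sets D" "i \<in> {1..n}"
  shows "prob {\<omega> \<in> space P. Z i \<omega> \<in> A} = measure D A"
proof -
  have "measure (distr P D (Z i)) A = prob (Z i -` A \<inter> space P)"
    by (rule measure_distr[OF Z_measurable[OF assms(2)] assms(1)])
  also have "Z i -` A \<inter> space P = {\<omega> \<in> space P. Z i \<omega> \<in> A}" by auto
  finally show ?thesis using distr_Z[OF assms(2)] by simp
qed

text \<open>
  For \<open>\<bar>l * f\<bar> \<le> 1\<close> the moment generating function is at most \<open>exp (l * E f + l\<^sup>2 * E f\<^sup>2)\<close>, because the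
  exponential lies below its quadratic upper bound. The variance proxy is the second moment, not the square of the
  bound \<open>L\<close>, which is what allows \<open>L\<close> to grow with the sample size.
\<close>

lemma chernoff_bounded:
  assumes f[measurable]: "f \<in> borel_measurable D" and bd: "\<And>z. z \<in> space D \<Longrightarrow> \<bar>f z\<bar> \<le> L"
    and B: "(\<integral>z. (f z)\<^sup>2 \<partial>D) \<le> B" and l: "l > 0" "l * L \<le> 1"
  shows "prob {\<omega> \<in> space P. (\<Sum>i=1..n. f (Z i \<omega>)) - real n * (\<integral>z. f z \<partial>D) \<ge> real n * t}
     \<le> exp (- real n * (l * t - l\<^sup>2 * B))"
proof -
  interpret D: prob_space D by (rule prob_space_D)
  define \<mu> where "\<mu> = (\<integral>z. f z \<partial>D)"
  have Zm[measurable]: "i \<in> {1..n} \<Longrightarrow> Z i \<in> measurable P D" for i by (rule Z_measurable)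
  have int_f: "integrable D f"
    by (rule D.integrable_const_bound[where B=L]) (use bd in auto)
  have int_f2: "integrable D (\<lambda>z. (f z)\<^sup>2)"
  proof (rule D.integrable_const_bound[where B="L\<^sup>2"])
    have "(f z)\<^sup>2 \<le> L\<^sup>2" if "z \<in> space D" for z
      using power_mono[OF bd[OF that] abs_ge_zero, of 2] by simp
    then show "AE z in D. norm ((f z)\<^sup>2) \<le> L\<^sup>2" by simp
  qed simp
  have lf: "\<bar>l * f z\<bar> \<le> 1" if "z \<in> space D" for z
  proof -
    have "\<bar>l * f z\<bar> \<le> l * L" using l(1) bd[OF that] by (simp add: abs_mult)
    with l(2) show ?thesis by simp
  qed
  have int_e: "integrable D (\<lambda>z. exp (l * f z))"
  proof (rule D.integrable_const_bound[where B="exp 1"])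
    show "AE z in D. norm (exp (l * f z)) \<le> exp 1"
      using lf by (auto simp: abs_le_iff)
  qed simp
  have "(\<integral>z. exp (l * f z) \<partial>D) \<le> (\<integral>z. 1 + l * f z + l\<^sup>2 * (f z)\<^sup>2 \<partial>D)"
    using int_e int_f int_f2 exp_le_quadratic[OF lf]
    by (intro integral_mono) (auto simp: power_mult_distrib)
  also have "\<dots> = 1 + l * \<mu> + l\<^sup>2 * (\<integral>z. (f z)\<^sup>2 \<partial>D)"
    using int_f int_f2 by (simp add: \<mu>_def D.prob_space)
  also have "\<dots> \<le> 1 + (l * \<mu> + l\<^sup>2 * B)" using B by (simp add: mult_left_mono)
  also have "\<dots> \<le> exp (l * \<mu> + l\<^sup>2 * B)" by (rule exp_ge_add_one_self)
  finally have mgf: "(\<integral>z. exp (l * f z) \<partial>D) \<le> exp (l * \<mu> + l\<^sup>2 * B)" .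
  have ind: "indep_vars (\<lambda>_. borel) (\<lambda>i \<omega>. exp (l * f (Z i \<omega>))) {1..n}"
    by (rule indep_vars_compose2[OF indep]) measurable
  have int_i: "integrable P (\<lambda>\<omega>. exp (l * f (Z i \<omega>)))" if "i \<in> {1..n}" for i
    using integrable_distr_eq[of "Z i" P D "\<lambda>z. exp (l * f z)"] int_e Z_measurable[OF that] distr_Z[OF that]
    by simp
  have E: "exp (l * (\<Sum>i=1..n. f (Z i \<omega>))) = (\<Prod>i=1..n. exp (l * f (Z i \<omega>)))" for \<omega>
    by (simp add: sum_distrib_left exp_sum)
  have int_S: "integrable P (\<lambda>\<omega>. exp (l * (\<Sum>i=1..n. f (Z i \<omega>))))"
    unfolding E by (rule indep_vars_integrable[OF _ ind int_i]) auto
  have "prob {\<omega> \<in> space P. (\<Sum>i=1..n. f (Z i \<omega>)) - real n * \<mu> \<ge> real n * t} =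
      prob {\<omega> \<in> space P. (\<Sum>i=1..n. f (Z i \<omega>)) \<ge> real n * (\<mu> + t)}"
    by (simp add: algebra_simps le_diff_eq)
  also have "\<dots> \<le> exp (- l * (real n * (\<mu> + t))) * (\<integral>\<omega>. exp (l * (\<Sum>i=1..n. f (Z i \<omega>))) \<partial>P)"
    using Chernoff_ineq_ge[of l "space P" "\<lambda>\<omega>. (\<Sum>i=1..n. f (Z i \<omega>))" "real n * (\<mu> + t)"]
      l(1) int_S
    by (simp add: set_integrable_def set_lebesgue_integral_def cong: Bochner_Integration.integrable_cong Bochner_Integration.integral_cong)
  also have "(\<integral>\<omega>. exp (l * (\<Sum>i=1..n. f (Z i \<omega>))) \<partial>P) = (\<Prod>i=1..n. \<integral>\<omega>. exp (l * f (Z i \<omega>)) \<partial>P)"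
    unfolding E by (rule indep_vars_lebesgue_integral[OF _ ind int_i]) auto
  also have "\<dots> = (\<integral>z. exp (l * f z) \<partial>D) ^ n"
    using integral_sample[of "\<lambda>z. exp (l * f z)"] by (simp add: prod.cong)
  also have "exp (- l * (real n * (\<mu> + t))) * (\<integral>z. exp (l * f z) \<partial>D) ^ n \<le>
      exp (- l * (real n * (\<mu> + t))) * exp (l * \<mu> + l\<^sup>2 * B) ^ n"
    by (intro mult_left_mono power_mono mgf) auto
  also have "\<dots> = exp (- real n * (l * t - l\<^sup>2 * B))"
    by (simp add: exp_of_nat_mult[symmetric] exp_add[symmetric] algebra_simps)
  finally show ?thesis unfolding \<mu>_def .
qed

text \<open>
  The unconstrained optimum \<open>t / (2 * B)\<close> of the exponent gives the Gaussian rate; it is admissible only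
  up to \<open>1 / L\<close>, beyond which the rate is linear in \<open>t\<close>.
\<close>

lemma bernstein_two_sided:
  assumes f[measurable]: "f \<in> borel_measurable D" and bd: "\<And>z. z \<in> space D \<Longrightarrow> \<bar>f z\<bar> \<le> L"
    and B: "(\<integral>z. (f z)\<^sup>2 \<partial>D) \<le> B" and pos: "L > 0" "B > 0" "t > 0"
  shows "prob {\<omega> \<in> space P. \<bar>(\<Sum>i=1..n. f (Z i \<omega>)) - real n * (\<integral>z. f z \<partial>D)\<bar> \<ge> real n * t}
     \<le> 2 * exp (- real n * t / 2 * min (1 / L) (t / (2 * B)))"
proof -
  define l where "l = min (1 / L) (t / (2 * B))"
  have l: "l > 0" "l * L \<le> 1" "l * B \<le> t / 2"
    using pos by (auto simp: l_def min_def field_simps)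
  have Zm[measurable]: "i \<in> {1..n} \<Longrightarrow> Z i \<in> measurable P D" for i by (rule Z_measurable)
  have exponent: "exp (- real n * (l * t - l\<^sup>2 * B)) \<le> exp (- real n * t / 2 * l)"
  proof -
    have "l * (l * B) \<le> l * (t / 2)" using l by (intro mult_left_mono) auto
    then have "real n * (l * t / 2) \<le> real n * (l * t - l\<^sup>2 * B)"
      by (intro mult_left_mono) (auto simp: power2_eq_square algebra_simps)
    then show ?thesis by (simp add: mult_ac)
  qed
  let ?S = "\<lambda>\<omega>. (\<Sum>i=1..n. f (Z i \<omega>))"
  let ?U = "{\<omega> \<in> space P. ?S \<omega> - real n * (\<integral>z. f z \<partial>D) \<ge> real n * t}"
  let ?V = "{\<omega> \<in> space P. (\<Sum>i=1..n. - f (Z i \<omega>)) - real n * (\<integral>z. - f z \<partial>D) \<ge> real n * t}"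
  have "prob {\<omega> \<in> space P. \<bar>?S \<omega> - real n * (\<integral>z. f z \<partial>D)\<bar> \<ge> real n * t} \<le> prob (?U \<union> ?V)"
    by (intro finite_measure_mono) (auto simp: sum_negf abs_if split: if_splits)
  also have "\<dots> \<le> prob ?U + prob ?V" by (intro measure_Un_le) auto
  also have "prob ?U \<le> exp (- real n * t / 2 * l)"
    using chernoff_bounded[OF f bd B l(1,2)] exponent by (rule order.trans)
  also have "prob ?V \<le> exp (- real n * t / 2 * l)"
  proof (rule order.trans[OF _ exponent], rule chernoff_bounded)
    show "\<bar>- f z\<bar> \<le> L" if "z \<in> space D" for z using bd[OF that] by simp
    show "(\<integral>z. (- f z)\<^sup>2 \<partial>D) \<le> B" using B by simp
  qed (use l in simp_all)
  finally show ?thesis by (simp add: l_def)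
qed

end

section \<open>The high-probability event for one coordinate\<close>

lemma integral_inner_square:
  assumes int: "\<And>k l. k < r \<Longrightarrow> l < r \<Longrightarrow> integrable M (\<lambda>z. f k z * f l z)"
  shows "(\<integral>z. (\<Sum>k<r. v k * f k z)\<^sup>2 \<partial>M) = quad_form r (\<lambda>k l. \<integral>z. f k z * f l z \<partial>M) v"
proof -
  have expand: "(\<Sum>k<r. v k * f k z)\<^sup>2 = (\<Sum>k<r. \<Sum>l<r. v k * v l * (f k z * f l z))" for z
    unfolding power2_eq_square sum_product by (simp add: mult_ac)
  have inner: "integrable M (\<lambda>z. \<Sum>l<r. v k * v l * (f k z * f l z))"
    "(\<integral>z. (\<Sum>l<r. v k * v l * (f k z * f l z)) \<partial>M) = (\<Sum>l<r. v k * v l * (\<integral>z. f k z * f l z \<partial>M))"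
    if "k < r" for k
    using int[OF that] by (auto intro!: Bochner_Integration.integrable_sum simp: Bochner_Integration.integral_sum)
  have "(\<integral>z. (\<Sum>k<r. v k * f k z)\<^sup>2 \<partial>M) = (\<Sum>k<r. \<Sum>l<r. v k * v l * (\<integral>z. f k z * f l z \<partial>M))"
    unfolding expand by (subst Bochner_Integration.integral_sum) (simp_all add: inner)
  then show ?thesis unfolding quad_form_def by (simp add: sum_distrib_left mult_ac)
qed

text \<open>
  The tail condition is on the Euclidean norm \<open>g\<close> of the vector \<open>G\<close>. It bounds every moment of \<open>g\<close>, and
  hence every mixed moment of the coordinates, in terms of \<open>K\<close>, \<open>a\<close> and \<open>\<gamma>\<close> alone.
\<close>

locale weibull_vector = prob_space D for D :: "'b measure" +
  fixes G :: "nat \<Rightarrow> 'b \<Rightarrow> real" and r :: nat and K a \<gamma> :: real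
  assumes G_meas: "k < r \<Longrightarrow> G k \<in> borel_measurable D"
    and pos: "a > 0" "\<gamma> > 0" "K > 0"
    and tail: "u > 0 \<Longrightarrow> prob {z \<in> space D. sqrt (\<Sum>k<r. (G k z)\<^sup>2) \<ge> u} \<le> K * exp (- a * u powr \<gamma>)"
begin

definition g :: "'b \<Rightarrow> real" where "g z = sqrt (\<Sum>k<r. (G k z)\<^sup>2)"

lemma g_nonneg [simp]: "0 \<le> g z"
  by (auto simp: g_def intro: sum_nonneg)

lemma g_meas [measurable]: "g \<in> borel_measurable D"
  unfolding g_def using G_meas by measurable

abbreviation mom :: "nat \<Rightarrow> real" where "mom q \<equiv> weibull_moment K a \<gamma> q"

lemma mom_pos: "mom q > 0"
  using weibull_moment_ge_1[OF pos, of q] by linarith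

lemma g_moment: "integrable D (\<lambda>z. g z ^ q)" "(\<integral>z. g z ^ q \<partial>D) \<le> mom q"
  using weibull_tail_moment[of g K a \<gamma> q] tail pos by (simp_all add: g_def[symmetric])

lemma abs_G_le: "k < r \<Longrightarrow> \<bar>G k z\<bar> \<le> g z"
  unfolding g_def using member_le_sum[of k "{..<r}" "\<lambda>k. (G k z)\<^sup>2"] by (intro real_le_rsqrt) simp

lemma sq_inner_le: "(\<Sum>k<r. v k * G k z)\<^sup>2 \<le> (\<Sum>k<r. (v k)\<^sup>2) * (g z)\<^sup>2"
  unfolding g_def using Cauchy_Schwarz_ineq_sum[of v "\<lambda>k. G k z" "{..<r}"] by (simp add: sum_nonneg)

lemma integrable_le_power:
  assumes "f \<in> borel_measurable D" "\<And>z. z \<in> space D \<Longrightarrow> \<bar>f z\<bar> \<le> C * g z ^ q"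
  shows "integrable D f"
proof (rule Bochner_Integration.integrable_bound)
  show "integrable D (\<lambda>z. C * g z ^ q)" using g_moment(1) by simp
  show "AE z in D. norm (f z) \<le> norm (C * g z ^ q)"
    by (rule AE_I2) (metis assms(2) abs_ge_self order.trans real_norm_def)
qed fact

text \<open>
  Markov-type bound: where \<open>g \<ge> T\<close>, a factor \<open>(g / T) ^ q \<ge> 1\<close> is available. Taking \<open>q\<close> large makes
  the bias of truncation smaller than any given power of the sample size.
\<close>

lemma truncated_moment:
  assumes T: "T > 0"
  shows "(\<integral>z. (if g z < T then 0 else g z ^ p) \<partial>D) \<le> mom (p + q) / T ^ q"
proof -
  have le: "(if g z < T then 0 else g z ^ p) \<le> g z ^ (p + q) / T ^ q" for z
  proof (cases "g z < T")
    case False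
    have "g z ^ p * T ^ q \<le> g z ^ p * g z ^ q"
      using False T by (intro mult_left_mono power_mono) auto
    then show ?thesis using False T by (simp add: field_simps power_add)
  qed (use T in simp)
  have "(\<integral>z. (if g z < T then 0 else g z ^ p) \<partial>D) \<le> (\<integral>z. g z ^ (p + q) / T ^ q \<partial>D)"
  proof (rule integral_mono)
    show "integrable D (\<lambda>z. if g z < T then 0 else g z ^ p)"
      by (rule integrable_le_power[where C=1 and q=p]) auto
    show "integrable D (\<lambda>z. g z ^ (p + q) / T ^ q)" using g_moment(1) by simp
  qed (rule le)
  also have "\<dots> \<le> mom (p + q) / T ^ q"
    using T g_moment(2)[of "p + q"] by (simp add: divide_right_mono)
  finally show ?thesis .
qed

lemma integrable_G_mult: "k < r \<Longrightarrow> l < r \<Longrightarrow> integrable D (\<lambda>z. G k z * G l z)"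
  using abs_G_le G_meas
  by (intro integrable_le_power[where C=1 and q=2])
    (auto simp: abs_mult power2_eq_square intro!: mult_mono borel_measurable_times)

lemma integral_inner_sq:
  "(\<integral>z. (\<Sum>k<r. v k * G k z)\<^sup>2 \<partial>D) = quad_form r (\<lambda>k l. \<integral>z. G k z * G l z \<partial>D) v"
  by (rule integral_inner_square) (rule integrable_G_mult)

definition trunc :: "real \<Rightarrow> nat \<Rightarrow> 'b \<Rightarrow> real" where
  "trunc T k z = (if g z < T then G k z else 0)"

lemma trunc_meas: "k < r \<Longrightarrow> trunc T k \<in> borel_measurable D"
  using G_meas unfolding trunc_def by measurable

lemma abs_trunc_le: "k < r \<Longrightarrow> T > 0 \<Longrightarrow> \<bar>trunc T k z\<bar> \<le> T"
  using abs_G_le[of k z] by (auto simp: trunc_def)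

lemma trunc_second_moment: "k < r \<Longrightarrow> (\<integral>z. (trunc T k z)\<^sup>2 \<partial>D) \<le> mom 2"
proof -
  assume k: "k < r"
  have le: "(trunc T k z)\<^sup>2 \<le> g z ^ 2" for z
    using power_mono[OF abs_G_le[OF k] abs_ge_zero, of z 2] by (simp add: trunc_def)
  have "(\<integral>z. (trunc T k z)\<^sup>2 \<partial>D) \<le> (\<integral>z. g z ^ 2 \<partial>D)"
    using trunc_meas[OF k] le
    by (intro integral_mono g_moment integrable_le_power[where C=1 and q=2]) auto
  also have "\<dots> \<le> mom 2" by (rule g_moment)
  finally show ?thesis .
qed

lemma trunc_mean:
  assumes k: "k < r" and T: "T > 0"
  shows "\<bar>\<integral>z. trunc T k z \<partial>D\<bar> \<le> \<bar>\<integral>z. G k z \<partial>D\<bar> + mom (q + 1) / T ^ q"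
proof -
  have iG: "integrable D (G k)"
    by (rule integrable_le_power[where C=1 and q=1]) (use G_meas k abs_G_le in auto)
  have iT: "integrable D (trunc T k)"
    by (rule integrable_le_power[where C=1 and q=1]) (use trunc_meas k abs_G_le in \<open>auto simp: trunc_def\<close>)
  have "\<bar>(\<integral>z. trunc T k z \<partial>D) - (\<integral>z. G k z \<partial>D)\<bar> = \<bar>\<integral>z. trunc T k z - G k z \<partial>D\<bar>"
    using iG iT by simp
  also have "\<dots> \<le> (\<integral>z. \<bar>trunc T k z - G k z\<bar> \<partial>D)" by (rule integral_abs_bound)
  also have "\<dots> \<le> (\<integral>z. (if g z < T then 0 else g z ^ 1) \<partial>D)"
  proof (rule integral_mono)
    show "integrable D (\<lambda>z. \<bar>trunc T k z - G k z\<bar>)" using iG iT by auto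
    show "integrable D (\<lambda>z. if g z < T then 0 else g z ^ 1)"
      by (rule integrable_le_power[where C=1 and q=1]) auto
    show "\<bar>trunc T k z - G k z\<bar> \<le> (if g z < T then 0 else g z ^ 1)" for z
      using abs_G_le[OF k, of z] by (auto simp: trunc_def)
  qed
  also have "\<dots> \<le> mom (1 + q) / T ^ q" by (rule truncated_moment[OF T])
  finally show ?thesis by (simp add: add.commute)
qed

end

text \<open>
  By a Markov-type bound with the third moment, clipping at this level removes at most
  \<open>c / 4\<close> from the smallest eigenvalue of the second moment matrix.
\<close>

definition clip_level :: "real \<Rightarrow> real \<Rightarrow> real \<Rightarrow> real \<Rightarrow> real" where
  "clip_level K a \<gamma> c = 4 * weibull_moment K a \<gamma> 3 / c"

text \<open>
  Entrywise errors of this size perturb a quadratic form in the largest possible dimension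
  \<open>weibull_moment K a \<gamma> 2 / c\<close> by at most \<open>c / 4\<close> times the squared norm.
\<close>

definition gram_tol :: "real \<Rightarrow> real \<Rightarrow> real \<Rightarrow> real \<Rightarrow> real" where
  "gram_tol K a \<gamma> c = c\<^sup>2 / (4 * weibull_moment K a \<gamma> 2)"

text \<open>
  The exponential rate at which one entry of the Gram matrix of the clipped vectors deviates by more than
  \<open>gram_tol\<close>; the entries are bounded by the square of the clipping level.
\<close>

definition gram_rate :: "real \<Rightarrow> real \<Rightarrow> real \<Rightarrow> real \<Rightarrow> real" where
  "gram_rate K a \<gamma> c = gram_tol K a \<gamma> c / 2 *
     min (1 / (clip_level K a \<gamma> c)\<^sup>2) (gram_tol K a \<gamma> c / (2 * (clip_level K a \<gamma> c) ^ 4))"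

locale tailed_vector = weibull_vector D G r K a \<gamma>
  for D :: "'b measure" and G :: "nat \<Rightarrow> 'b \<Rightarrow> real" and r :: nat and K a \<gamma> :: real +
  fixes c :: real
  assumes c_pos: "c > 0"
    and quad_ge: "c * (\<Sum>k<r. (v k)\<^sup>2) \<le> (\<integral>z. (\<Sum>k<r. v k * G k z)\<^sup>2 \<partial>D)"
begin

text \<open>
  The trace of the second moment matrix is at least \<open>r * c\<close> by the eigenvalue bound and at most the second
  moment of the norm by the tail bound.
\<close>

lemma dim_le: "real r \<le> mom 2 / c"
proof -
  have "c \<le> (\<integral>z. (G k z)\<^sup>2 \<partial>D)" if k: "k < r" for k
  proof -
    have "(\<Sum>l<r. (if l = k then 1 else 0) * G l z) = G k z" for z
      using k by (simp add: if_distribR if_distrib[of "\<lambda>x. x * _"] cong: if_cong)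
    moreover have "(\<Sum>l<r. (if l = k then 1 else (0::real))\<^sup>2) = 1"
      using k by (simp add: if_distrib[of "\<lambda>x. x\<^sup>2"] cong: if_cong)
    ultimately show ?thesis using quad_ge[of "\<lambda>l. if l = k then 1 else 0"] by simp
  qed
  then have "(\<Sum>k<r. c) \<le> (\<Sum>k<r. \<integral>z. (G k z)\<^sup>2 \<partial>D)" by (intro sum_mono) auto
  also have "\<dots> = (\<integral>z. (\<Sum>k<r. (G k z)\<^sup>2) \<partial>D)"
  proof (rule Bochner_Integration.integral_sum[symmetric])
    show "integrable D (\<lambda>z. (G k z)\<^sup>2)" if "k \<in> {..<r}" for k
      using that G_meas abs_G_le power_mono[OF abs_G_le abs_ge_zero, of k _ 2]
      by (intro integrable_le_power[where C=1 and q=2]) auto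
  qed
  also have "\<dots> = (\<integral>z. g z ^ 2 \<partial>D)" by (simp add: g_def sum_nonneg)
  also have "\<dots> \<le> mom 2" by (rule g_moment)
  finally show ?thesis using c_pos by (simp add: field_simps)
qed

abbreviation L0 :: real where "L0 \<equiv> clip_level K a \<gamma> c"

lemma L0_pos: "L0 > 0" unfolding clip_level_def using mom_pos c_pos by simp

abbreviation Y :: "'b \<Rightarrow> nat \<Rightarrow> real" where "Y z \<equiv> clip r L0 (\<lambda>k. G k z)"

lemma Y_eq: "Y z k = (if g z \<le> L0 then G k z else 0)"
proof -
  have "g z \<le> L0 \<longleftrightarrow> (\<Sum>l<r. (G l z)\<^sup>2) \<le> L0\<^sup>2"
    unfolding g_def using L0_pos by (metis less_imp_le real_sqrt_le_iff real_sqrt_unique)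
  then show ?thesis by (simp add: clip_def)
qed

lemma Y_meas: "k < r \<Longrightarrow> (\<lambda>z. Y z k) \<in> borel_measurable D"
  using G_meas unfolding Y_eq by measurable

lemma abs_Y_le: "k < r \<Longrightarrow> \<bar>Y z k\<bar> \<le> L0"
  using abs_G_le[of k z] L0_pos by (auto simp: Y_eq)

lemma abs_Y_mult_le: "k < r \<Longrightarrow> l < r \<Longrightarrow> \<bar>Y z k * Y z l\<bar> \<le> L0\<^sup>2"
  unfolding abs_mult power2_eq_square using abs_Y_le L0_pos by (intro mult_mono) auto

lemma integrable_Y_mult: "k < r \<Longrightarrow> l < r \<Longrightarrow> integrable D (\<lambda>z. Y z k * Y z l)"
  using Y_meas abs_Y_mult_le by (intro integrable_const_bound[where B="L0\<^sup>2"]) auto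

text \<open>
  The part of the quadratic form that clipping removes is at most
  \<open>|v|\<^sup>2 * E (g\<^sup>2; g \<ge> L0)\<close>, which the choice of the clipping level makes at most \<open>c / 4 * |v|\<^sup>2\<close>.
\<close>

lemma clipped_second_moment:
  "3 / 4 * c * (\<Sum>k<r. (v k)\<^sup>2) \<le> quad_form r (\<lambda>k l. \<integral>z. Y z k * Y z l \<partial>D) v"
proof -
  let ?N = "\<Sum>k<r. (v k)\<^sup>2"
  have N: "?N \<ge> 0" by (intro sum_nonneg) auto
  have m1: "(\<lambda>z. (\<Sum>k<r. v k * G k z)\<^sup>2) \<in> borel_measurable D"
    using G_meas by measurable
  have m2: "(\<lambda>z. (\<Sum>k<r. v k * Y z k)\<^sup>2) \<in> borel_measurable D"
    using Y_meas by measurable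
  have i1: "integrable D (\<lambda>z. (\<Sum>k<r. v k * G k z)\<^sup>2)"
    by (rule integrable_le_power[where C="?N" and q=2, OF m1]) (use sq_inner_le in simp)
  have Y_split: "(\<Sum>k<r. v k * Y z k)\<^sup>2 = (if g z \<le> L0 then (\<Sum>k<r. v k * G k z)\<^sup>2 else 0)" for z
    by (simp add: Y_eq)
  have i2: "integrable D (\<lambda>z. (\<Sum>k<r. v k * Y z k)\<^sup>2)"
    by (rule integrable_le_power[where C="?N" and q=2, OF m2]) (use sq_inner_le N in \<open>auto simp: Y_split\<close>)
  have i3: "integrable D (\<lambda>z. if g z < L0 then 0 else (g z)\<^sup>2)"
    by (rule integrable_le_power[where C=1 and q=2]) auto
  have le: "(\<Sum>k<r. v k * G k z)\<^sup>2 \<le> (\<Sum>k<r. v k * Y z k)\<^sup>2 + ?N * (if g z < L0 then 0 else (g z)\<^sup>2)" for z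
    using sq_inner_le[of v z] N by (auto simp: Y_split)
  have "c * ?N \<le> (\<integral>z. (\<Sum>k<r. v k * G k z)\<^sup>2 \<partial>D)" by (rule quad_ge)
  also have "\<dots> \<le> (\<integral>z. (\<Sum>k<r. v k * Y z k)\<^sup>2 + ?N * (if g z < L0 then 0 else (g z)\<^sup>2) \<partial>D)"
    using i1 i2 i3 le by (intro integral_mono Bochner_Integration.integrable_add integrable_mult_right)
  also have "\<dots> = (\<integral>z. (\<Sum>k<r. v k * Y z k)\<^sup>2 \<partial>D) + ?N * (\<integral>z. (if g z < L0 then 0 else (g z)\<^sup>2) \<partial>D)"
    using i2 i3 by (subst Bochner_Integration.integral_add) (auto simp del: mult_if_delta)
  also have "\<dots> \<le> (\<integral>z. (\<Sum>k<r. v k * Y z k)\<^sup>2 \<partial>D) + ?N * (c / 4)"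
  proof (intro add_left_mono mult_left_mono N)
    have "(\<integral>z. (if g z < L0 then 0 else (g z)\<^sup>2) \<partial>D) \<le> mom 3 / L0"
      using truncated_moment[OF L0_pos, of 2 1] by (simp add: numeral_3_eq_3)
    also have "\<dots> = c / 4" unfolding clip_level_def using mom_pos[of 3] by simp
    finally show "(\<integral>z. (if g z < L0 then 0 else (g z)\<^sup>2) \<partial>D) \<le> c / 4" .
  qed
  finally have "3 / 4 * c * ?N \<le> (\<integral>z. (\<Sum>k<r. v k * Y z k)\<^sup>2 \<partial>D)" by (simp add: algebra_simps)
  also have "\<dots> = quad_form r (\<lambda>k l. \<integral>z. Y z k * Y z l \<partial>D) v"
    by (rule integral_inner_square) (rule integrable_Y_mult)
  finally show ?thesis .
qed

abbreviation tol :: real where "tol \<equiv> gram_tol K a \<gamma> c"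

lemma tol_pos: "tol > 0" unfolding gram_tol_def using mom_pos c_pos by simp

lemma dim_tol_le: "real r * tol \<le> c / 4"
proof -
  have "real r * tol \<le> mom 2 / c * tol" using dim_le tol_pos by (intro mult_right_mono) auto
  also have "\<dots> = c / 4" unfolding gram_tol_def using mom_pos[of 2] c_pos by (simp add: power2_eq_square)
  finally show ?thesis .
qed

text \<open>
  Half of the eigenvalue bound survives in the sample: a quarter is lost by clipping and a quarter by the
  deviation of the entries, whose effect is at most \<open>tol * (\<Sum>\<bar>v k\<bar>)\<^sup>2 \<le> tol * r * |v|\<^sup>2\<close>.
\<close>

lemma coercive_of_close:
  fixes z :: "nat \<Rightarrow> 'b"
  assumes close: "\<And>k l. k < r \<Longrightarrow> l < r \<Longrightarrow>
    \<bar>(\<Sum>i=1..n. Y (z i) k * Y (z i) l) / real n - (\<integral>z. Y z k * Y z l \<partial>D)\<bar> \<le> tol"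
  shows "c / 2 * (\<Sum>k<r. (v k)\<^sup>2) \<le> (\<Sum>i=1..n. (\<Sum>k<r. v k * Y (z i) k)\<^sup>2) / real n"
proof -
  define M where "M k l = (\<integral>z. Y z k * Y z l \<partial>D)" for k l
  define S where "S k l = (\<Sum>i=1..n. Y (z i) k * Y (z i) l) / real n" for k l
  let ?N = "\<Sum>k<r. (v k)\<^sup>2"
  have N: "?N \<ge> 0" by (intro sum_nonneg) auto
  have expand: "(\<Sum>i=1..n. (\<Sum>k<r. v k * Y (z i) k)\<^sup>2) / real n = (\<Sum>k<r. \<Sum>l<r. v k * v l * S k l)"
  proof -
    have "(\<Sum>k<r. \<Sum>l<r. v k * v l * S k l) =
        (\<Sum>k<r. \<Sum>l<r. \<Sum>i=1..n. (v k * Y (z i) k) * (v l * Y (z i) l)) / real n"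
      unfolding S_def by (simp add: sum_distrib_left sum_divide_distrib mult_ac)
    also have "(\<Sum>k<r. \<Sum>l<r. \<Sum>i=1..n. (v k * Y (z i) k) * (v l * Y (z i) l)) =
        (\<Sum>k<r. \<Sum>i=1..n. \<Sum>l<r. (v k * Y (z i) k) * (v l * Y (z i) l))"
      by (intro sum.cong refl sum.swap)
    also have "\<dots> = (\<Sum>i=1..n. \<Sum>k<r. \<Sum>l<r. (v k * Y (z i) k) * (v l * Y (z i) l))"
      by (rule sum.swap)
    also have "\<dots> = (\<Sum>i=1..n. (\<Sum>k<r. v k * Y (z i) k)\<^sup>2)"
      unfolding power2_eq_square sum_product ..
    finally show ?thesis ..
  qed
  have expectation: "quad_form r (\<lambda>k l. \<integral>z. Y z k * Y z l \<partial>D) v = (\<Sum>k<r. \<Sum>l<r. v k * v l * M k l)"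
    unfolding quad_form_def M_def by (simp add: sum_distrib_left mult_ac)
  have "(\<Sum>k<r. \<Sum>l<r. v k * v l * M k l) - (\<Sum>k<r. \<Sum>l<r. v k * v l * S k l) \<le>
      (\<Sum>k<r. \<Sum>l<r. \<bar>v k\<bar> * \<bar>v l\<bar> * tol)"
    unfolding sum_subtractf[symmetric]
  proof (intro sum_mono)
    fix k l assume kl: "k \<in> {..<r}" "l \<in> {..<r}"
    have "v k * v l * M k l - v k * v l * S k l \<le> \<bar>v k * v l * (S k l - M k l)\<bar>"
      by (simp add: right_diff_distrib)
    also have "\<dots> \<le> \<bar>v k\<bar> * \<bar>v l\<bar> * tol"
      unfolding abs_mult using close[of k l] kl by (intro mult_left_mono) (auto simp: S_def M_def)
    finally show "v k * v l * M k l - v k * v l * S k l \<le> \<bar>v k\<bar> * \<bar>v l\<bar> * tol" .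
  qed
  also have "\<dots> = (\<Sum>k<r. \<bar>v k\<bar> * 1)\<^sup>2 * tol"
    unfolding power2_eq_square sum_product by (simp add: sum_distrib_right)
  also have "\<dots> \<le> (?N * real r) * tol"
    using Cauchy_Schwarz_ineq_sum[of "\<lambda>k. \<bar>v k\<bar>" "\<lambda>_. 1" "{..<r}"] tol_pos
    by (intro mult_right_mono) auto
  also have "\<dots> \<le> ?N * (c / 4)"
    using mult_left_mono[OF dim_tol_le N] by (simp add: mult.assoc)
  finally show ?thesis
    unfolding expand using clipped_second_moment[of v] unfolding expectation by (simp add: algebra_simps)
qed

end

locale tailed_sample = V?: tailed_vector D G r K a \<gamma> c + iid_sample P D Z n
  for P :: "'a measure" and D :: "'b measure" and Z n G r K a \<gamma> c
begin

text \<open>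
  The bad event has three parts: some observation reaches the truncation level \<open>T\<close>, some entry of the
  clipped Gram matrix deviates by \<open>tol\<close>, or some coordinate mean of the truncated vectors deviates by
  \<open>t / 2\<close>. Off the first part truncated and original sample means agree, so off the third part they
  are at most \<open>t\<close>, given that expectation and truncation bias together contribute at most \<open>t / 2\<close>.
\<close>

lemma weights_off_bad_event:
  assumes T: "T > 0" and t: "t > 0"
    and bias: "\<And>k. k < r \<Longrightarrow> \<bar>\<integral>z. G k z \<partial>D\<bar> + mom (q + 1) / T ^ q \<le> t / 2"
    and small: "16 * L0 * sqrt (mom 2 / c) * t \<le> c"
  obtains E where "E \<in> events"
    "prob E \<le> real n * (K * exp (- a * T powr \<gamma>)) + 2 * (mom 2 / c)\<^sup>2 * exp (- gram_rate K a \<gamma> c * real n)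
       + 2 * (mom 2 / c) * exp (- real n * t / 4 * min (1 / T) (t / (4 * mom 2)))"
    "\<And>\<omega>. \<omega> \<in> space P - E \<Longrightarrow> \<exists>w. (\<forall>i\<in>{1..n}. w i > 0) \<and> (\<Sum>i=1..n. w i) = 1 \<and>
        (\<forall>k<r. (\<Sum>i=1..n. w i * G k (Z i \<omega>)) = 0) \<and>
        - 2 * (\<Sum>i=1..n. ln (real n * w i)) \<le> 256 * real n * L0\<^sup>2 / c\<^sup>2 * (mom 2 / c * t\<^sup>2)"
proof -
  define R where "R = mom 2 / c"
  have R: "R > 0" "real r \<le> R" using mom_pos[of 2] c_pos dim_le by (auto simp: R_def)
  have Zm[measurable]: "i \<in> {1..n} \<Longrightarrow> Z i \<in> measurable P D" for i by (rule Z_measurable)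
  define A1 where "A1 i = {\<omega> \<in> space P. Z i \<omega> \<in> {z \<in> space D. g z \<ge> T}}" for i
  define A2 where "A2 k l = {\<omega> \<in> space P.
     \<bar>(\<Sum>i=1..n. Y (Z i \<omega>) k * Y (Z i \<omega>) l) - real n * (\<integral>z. Y z k * Y z l \<partial>D)\<bar> \<ge> real n * tol}" for k l
  define A3 where "A3 k = {\<omega> \<in> space P.
     \<bar>(\<Sum>i=1..n. trunc T k (Z i \<omega>)) - real n * (\<integral>z. trunc T k z \<partial>D)\<bar> \<ge> real n * (t / 2)}" for k
  define E1 E2 E3 where "E1 = (\<Union>i\<in>{1..n}. A1 i)"
    and "E2 = (\<Union>q\<in>{..<r} \<times> {..<r}. A2 (fst q) (snd q))" and "E3 = (\<Union>k\<in>{..<r}. A3 k)"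
  have A1_ev: "A1 i \<in> events" if "i \<in> {1..n}" for i
    unfolding A1_def by (rule measurable_sets_Collect[OF Zm[OF that]]) measurable
  have A2_ev: "A2 k l \<in> events" if "k < r" "l < r" for k l
  proof -
    have [measurable]: "(\<lambda>z. Y z k) \<in> borel_measurable D" "(\<lambda>z. Y z l) \<in> borel_measurable D"
      using that by (auto intro: Y_meas)
    show ?thesis unfolding A2_def by measurable
  qed
  have A3_ev: "A3 k \<in> events" if "k < r" for k
  proof -
    have [measurable]: "trunc T k \<in> borel_measurable D" using that by (rule trunc_meas)
    show ?thesis unfolding A3_def by measurable
  qed
  have ev: "E1 \<in> events" "E2 \<in> events" "E3 \<in> events"
    unfolding E1_def E2_def E3_def using A1_ev A2_ev A3_ev by (auto intro!: sets.finite_UN)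
  have q1: "prob (A1 i) \<le> K * exp (- a * T powr \<gamma>)" if i: "i \<in> {1..n}" for i
  proof -
    have "prob (A1 i) = measure D {z \<in> space D. g z \<ge> T}"
      unfolding A1_def by (rule prob_sample[OF _ i]) measurable
    also have "\<dots> \<le> K * exp (- a * T powr \<gamma>)" unfolding g_def by (rule tail[OF T])
    finally show ?thesis .
  qed
  have q2: "prob (A2 k l) \<le> 2 * exp (- gram_rate K a \<gamma> c * real n)" if kl: "k < r" "l < r" for k l
  proof -
    have "prob (A2 k l) \<le> 2 * exp (- real n * tol / 2 * min (1 / L0\<^sup>2) (tol / (2 * L0 ^ 4)))"
      unfolding A2_def
    proof (rule bernstein_two_sided)
      show m: "(\<lambda>z. Y z k * Y z l) \<in> borel_measurable D"
        by (intro borel_measurable_times Y_meas kl)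
      show bd: "\<bar>Y z k * Y z l\<bar> \<le> L0\<^sup>2" for z by (rule abs_Y_mult_le[OF kl])
      have le: "(Y z k * Y z l)\<^sup>2 \<le> L0 ^ 4" for z
        using power_mono[OF bd abs_ge_zero, of z 2] by (simp flip: power_mult)
      have "(\<integral>z. (Y z k * Y z l)\<^sup>2 \<partial>D) \<le> (\<integral>z. L0 ^ 4 \<partial>D)"
      proof (rule integral_mono)
        show "integrable D (\<lambda>z. (Y z k * Y z l)\<^sup>2)"
          by (rule V.integrable_const_bound[where B="L0 ^ 4"]) (use le m in simp_all)
      qed (use le in simp_all)
      then show "(\<integral>z. (Y z k * Y z l)\<^sup>2 \<partial>D) \<le> L0 ^ 4" by (simp add: V.prob_space)
    qed (use L0_pos tol_pos in simp_all)
    then show ?thesis by (simp add: gram_rate_def mult_ac)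
  qed
  have q3: "prob (A3 k) \<le> 2 * exp (- real n * t / 4 * min (1 / T) (t / (4 * mom 2)))" if k: "k < r" for k
  proof -
    have "prob (A3 k) \<le> 2 * exp (- real n * (t / 2) / 2 * min (1 / T) (t / 2 / (2 * mom 2)))"
      unfolding A3_def
      by (rule bernstein_two_sided[OF trunc_meas[OF k] abs_trunc_le[OF k T] trunc_second_moment[OF k] T mom_pos])
        (use t in simp)
    then show ?thesis by simp
  qed
  have p1: "prob E1 \<le> real n * (K * exp (- a * T powr \<gamma>))"
  proof -
    have "prob E1 \<le> (\<Sum>i=1..n. prob (A1 i))"
      unfolding E1_def using A1_ev by (intro finite_measure_subadditive_finite) auto
    also have "\<dots> \<le> (\<Sum>i=1..n. K * exp (- a * T powr \<gamma>))" by (intro sum_mono q1)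
    finally show ?thesis by simp
  qed
  have p2: "prob E2 \<le> 2 * R\<^sup>2 * exp (- gram_rate K a \<gamma> c * real n)"
  proof -
    have "prob E2 \<le> (\<Sum>q\<in>{..<r} \<times> {..<r}. prob (A2 (fst q) (snd q)))"
      unfolding E2_def using A2_ev by (intro finite_measure_subadditive_finite) auto
    also have "\<dots> \<le> (\<Sum>q\<in>{..<r} \<times> {..<r}. 2 * exp (- gram_rate K a \<gamma> c * real n))"
      by (intro sum_mono q2) auto
    also have "\<dots> = 2 * (real r)\<^sup>2 * exp (- gram_rate K a \<gamma> c * real n)"
      by (simp add: power2_eq_square)
    also have "\<dots> \<le> 2 * R\<^sup>2 * exp (- gram_rate K a \<gamma> c * real n)"
      using R by (intro mult_right_mono mult_left_mono power_mono) auto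
    finally show ?thesis .
  qed
  have p3: "prob E3 \<le> 2 * R * exp (- real n * t / 4 * min (1 / T) (t / (4 * mom 2)))"
  proof -
    have "prob E3 \<le> (\<Sum>k<r. prob (A3 k))"
      unfolding E3_def using A3_ev by (intro finite_measure_subadditive_finite) auto
    also have "\<dots> \<le> (\<Sum>k<r. 2 * exp (- real n * t / 4 * min (1 / T) (t / (4 * mom 2))))"
      by (intro sum_mono q3) auto
    also have "\<dots> = real r * (2 * exp (- real n * t / 4 * min (1 / T) (t / (4 * mom 2))))"
      by simp
    also have "\<dots> \<le> R * (2 * exp (- real n * t / 4 * min (1 / T) (t / (4 * mom 2))))"
      using R by (intro mult_right_mono) auto
    finally show ?thesis by simp
  qed
  show ?thesis
  proof
    show "E1 \<union> E2 \<union> E3 \<in> events" using ev by auto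
    have "prob (E1 \<union> E2 \<union> E3) \<le> prob (E1 \<union> E2) + prob E3"
      using ev by (intro measure_Un_le) auto
    also have "prob (E1 \<union> E2) \<le> prob E1 + prob E2"
      using ev by (intro measure_Un_le) auto
    finally show "prob (E1 \<union> E2 \<union> E3) \<le> real n * (K * exp (- a * T powr \<gamma>)) +
       2 * (mom 2 / c)\<^sup>2 * exp (- gram_rate K a \<gamma> c * real n)
       + 2 * (mom 2 / c) * exp (- real n * t / 4 * min (1 / T) (t / (4 * mom 2)))"
      using p1 p2 p3 by (simp add: R_def)
  next
    fix \<omega> assume \<omega>: "\<omega> \<in> space P - (E1 \<union> E2 \<union> E3)"
    have Zs: "Z i \<omega> \<in> space D" if "i \<in> {1..n}" for i
      using measurable_space[OF Zm[OF that]] \<omega> by auto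
    have g_lt: "g (Z i \<omega>) < T" if "i \<in> {1..n}" for i
    proof -
      have "\<omega> \<notin> A1 i" using \<omega> that by (auto simp: E1_def)
      then show ?thesis using \<omega> Zs[OF that] by (auto simp: A1_def)
    qed
    have coercive: "c / 2 * (\<Sum>k<r. (v k)\<^sup>2) \<le> (\<Sum>i=1..n. (\<Sum>k<r. v k * Y (Z i \<omega>) k)\<^sup>2) / real n" for v
    proof (rule coercive_of_close)
      fix k l assume kl: "k < r" "l < r"
      define S M where "S = (\<Sum>i=1..n. Y (Z i \<omega>) k * Y (Z i \<omega>) l)" and "M = (\<integral>z. Y z k * Y z l \<partial>D)"
      have "\<bar>S - real n * M\<bar> < real n * tol"
      proof -
        have "\<omega> \<notin> A2 k l" using \<omega> kl by (force simp: E2_def)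
        then show ?thesis using \<omega> by (simp add: A2_def S_def M_def)
      qed
      moreover have "S - real n * M = real n * (S / real n - M)" using n_pos by (simp add: field_simps)
      ultimately have "\<bar>S / real n - M\<bar> < tol" using n_pos by (simp add: abs_mult)
      then show "\<bar>S / real n - M\<bar> \<le> tol" by simp
    qed
    define m where "m k = (\<Sum>i=1..n. G k (Z i \<omega>)) / real n" for k
    have m_le: "\<bar>m k\<bar> \<le> t" if k: "k < r" for k
    proof -
      define S M where "S = (\<Sum>i=1..n. trunc T k (Z i \<omega>))" and "M = (\<integral>z. trunc T k z \<partial>D)"
      have S: "S = (\<Sum>i=1..n. G k (Z i \<omega>))"
        unfolding S_def using g_lt by (intro sum.cong refl) (simp add: trunc_def)
      have "\<bar>S - real n * M\<bar> < real n * (t / 2)"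
      proof -
        have "\<omega> \<notin> A3 k" using \<omega> k by (auto simp: E3_def)
        then show ?thesis using \<omega> by (simp add: A3_def S_def M_def)
      qed
      moreover have "S - real n * M = real n * (m k - M)"
      proof -
        have "m k = S / real n" by (simp add: m_def S)
        then show ?thesis using n_pos by (simp add: right_diff_distrib)
      qed
      ultimately have "\<bar>m k - M\<bar> < t / 2" using n_pos by (simp add: abs_mult)
      moreover have "\<bar>M\<bar> \<le> t / 2"
        unfolding M_def by (rule order.trans[OF trunc_mean[OF k T] bias[OF k]])
      ultimately show ?thesis by linarith
    qed
    have m2: "(\<Sum>k<r. (m k)\<^sup>2) \<le> R * t\<^sup>2"
    proof -
      have "(\<Sum>k<r. (m k)\<^sup>2) \<le> (\<Sum>k<r. t\<^sup>2)"
        using power_mono[OF m_le abs_ge_zero, of _ 2] by (intro sum_mono) auto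
      also have "\<dots> \<le> R * t\<^sup>2" using R by (simp add: mult_right_mono)
      finally show ?thesis .
    qed
    have small': "8 * L0 * sqrt (\<Sum>k<r. (m k)\<^sup>2) \<le> c / 2"
    proof -
      have "sqrt (\<Sum>k<r. (m k)\<^sup>2) \<le> sqrt R * t"
        using real_sqrt_le_mono[OF m2] t by (simp add: real_sqrt_mult)
      then have "8 * L0 * sqrt (\<Sum>k<r. (m k)\<^sup>2) \<le> 8 * L0 * (sqrt R * t)"
        using L0_pos by (intro mult_left_mono) auto
      then show ?thesis using small by (simp add: R_def)
    qed
    obtain w where w: "\<And>i. i \<in> {1..n} \<Longrightarrow> w i > 0" "(\<Sum>i=1..n. w i) = 1"
      "\<And>k. k < r \<Longrightarrow> (\<Sum>i=1..n. w i * G k (Z i \<omega>)) = 0"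
      and le: "- 2 * (\<Sum>i=1..n. ln (real n * w i)) \<le> 64 * real n * L0\<^sup>2 / (c / 2)\<^sup>2 * (\<Sum>k<r. (m k)\<^sup>2)"
      using tilted_weights[where n=n and L=L0 and c="c / 2" and r=r and x="\<lambda>i k. G k (Z i \<omega>)"]
        n_pos L0_pos c_pos coercive small' unfolding m_def by auto
    have "- 2 * (\<Sum>i=1..n. ln (real n * w i)) \<le> 256 * real n * L0\<^sup>2 / c\<^sup>2 * (\<Sum>k<r. (m k)\<^sup>2)"
      using le by (simp add: power_divide)
    also have "\<dots> \<le> 256 * real n * L0\<^sup>2 / c\<^sup>2 * (R * t\<^sup>2)"
      using m2 by (intro mult_left_mono) auto
    finally show "\<exists>w. (\<forall>i\<in>{1..n}. w i > 0) \<and> (\<Sum>i=1..n. w i) = 1 \<and>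
        (\<forall>k<r. (\<Sum>i=1..n. w i * G k (Z i \<omega>)) = 0) \<and>
        - 2 * (\<Sum>i=1..n. ln (real n * w i)) \<le> 256 * real n * L0\<^sup>2 / c\<^sup>2 * (mom 2 / c * t\<^sup>2)"
      using w unfolding R_def by blast
  qed
qed

end

section \<open>Marginal empirical likelihood ratios of null coordinates\<close>

lemma norm_two_vec: "norm_two (Matrix.vec r f) = sqrt (\<Sum>k<r. (f k)\<^sup>2)"
  by (simp add: norm_two_def)

lemma norm_inf_vec_ge: "k < r \<Longrightarrow> \<bar>f k\<bar> \<le> norm_inf (Matrix.vec r f)"
  unfolding norm_inf_def by (intro Max_ge) auto

lemma marg_comp_measurable:
  assumes valid: "valid_model n m" and k: "k < card (marg_comps m j)"
  shows "(\<lambda>z. vec_index (marg_est m j z 0) k) \<in> borel_measurable (euclid (dim_obs m))"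
proof -
  have "finite (marg_comps m j)" by (simp add: marg_comps_def)
  then have "sorted_list_of_set (marg_comps m j) ! k \<in> marg_comps m j"
    using k by (metis length_sorted_list_of_set nth_mem set_sorted_list_of_set)
  then have "sorted_list_of_set (marg_comps m j) ! k \<in> {1..dim_est m}" by (simp add: marg_comps_def)
  moreover have "coord_par (dim_par m) j 0 \<in> space (euclid (dim_par m))"
    by (auto simp: coord_par_def space_PiM)
  ultimately show ?thesis
    using valid k by (simp add: valid_model_def marg_est_def)
qed

lemma (in prob_space) indep_vars_sets_cong:
  assumes "indep_vars (\<lambda>_. M') X I" and "sets M' = sets N"
  shows "indep_vars (\<lambda>_. N) X I"
  using indep_vars_compose2[OF assms(1), of "\<lambda>_ x. x" "\<lambda>_. N"] assms(2)
  by (simp add: measurable_ident_sets)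

text \<open>
  The marginal estimating function of one coordinate under the law of the observation is an instance of
  the preceding setting: its second moment matrix is the given one, so that the smallest eigenvalue bounds
  the quadratic form.
\<close>

lemma null_coordinate_ELR_bound:
  fixes m :: "'a ee_model" and K a \<gamma> c :: real
  defines "M q \<equiv> weibull_moment K a \<gamma> q" and "L \<equiv> clip_level K a \<gamma> c"
  assumes valid: "valid_model n m" and n: "n > 0" and j: "j \<in> {1..dim_par m}"
    and pos: "a > 0" "\<gamma> > 0" "K > 0" "c > 0"
    and tail: "\<And>u. u > 0 \<Longrightarrow> measure (prob_sp m)
          {\<omega> \<in> space (prob_sp m). norm_two (marg_est m j (obs m \<omega>) 0) \<ge> u} \<le> K * exp (- a * u powr \<gamma>)"
    and eig: "lambda_min (marg_second_moment m j) \<ge> c"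
    and T: "T > 0" and t: "t > 0"
    and bias: "norm_inf (marg_mean m j) + M (q + 1) / T ^ q \<le> t / 2"
    and small: "16 * L * sqrt (M 2 / c) * t \<le> c"
  obtains E where "E \<in> sets (prob_sp m)"
    "measure (prob_sp m) E \<le> real n * (K * exp (- a * T powr \<gamma>)) + 2 * (M 2 / c)\<^sup>2 * exp (- gram_rate K a \<gamma> c * real n)
       + 2 * (M 2 / c) * exp (- real n * t / 4 * min (1 / T) (t / (4 * M 2)))"
    "\<And>\<omega>. \<omega> \<in> space (prob_sp m) - E \<Longrightarrow>
       marg_ELR n m j \<omega> \<le> ereal (256 * real n * L\<^sup>2 / c\<^sup>2 * (M 2 / c * t\<^sup>2))"
proof -
  define P where "P = prob_sp m"
  define N where "N = euclid (dim_obs m)"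
  define D where "D = distr P N (obs m)"
  define r where "r = card (marg_comps m j)"
  define G where "G k z = vec_index (marg_est m j z 0) k" for k z
  have v: "prob_space P" "obs m \<in> measurable P N" "prob_space.indep_vars P (\<lambda>_. N) (sample m) {1..n}"
    "\<And>i. i \<in> {1..n} \<Longrightarrow> distr P N (sample m i) = D" and r: "r \<ge> 1"
    using valid[unfolded valid_model_def] j unfolding P_def N_def D_def r_def by blast+
  interpret P: prob_space P by (rule v)
  have D: "prob_space D" unfolding D_def by (rule P.prob_space_distr[OF v(2)])
  have sets_D [measurable_cong]: "sets D = sets N" by (simp add: D_def)
  have G_N: "G k \<in> borel_measurable N" if "k < r" for k
    unfolding G_def N_def by (rule marg_comp_measurable[OF valid]) (use that in \<open>simp add: r_def\<close>)
  have int_D: "(\<integral>z. f z \<partial>D) = (\<integral>\<omega>. f (obs m \<omega>) \<partial>P)" if "f \<in> borel_measurable N" for f :: "_ \<Rightarrow> real"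
    unfolding D_def by (rule integral_distr[OF v(2) that])
  have est: "marg_est m j z 0 = Matrix.vec r (\<lambda>k. G k z)" for z
    by (rule eq_vecI) (auto simp: marg_est_def r_def G_def)
  interpret W: weibull_vector D G r K a \<gamma>
  proof (rule weibull_vector.intro[OF D], unfold_locales)
    show "G k \<in> borel_measurable D" if "k < r" for k using G_N[OF that] by (simp add: D_def)
    fix u :: real assume u: "u > 0"
    have "(\<lambda>z. sqrt (\<Sum>k<r. (G k z)\<^sup>2)) \<in> borel_measurable N" using G_N by measurable
    then have meas: "{z \<in> space N. sqrt (\<Sum>k<r. (G k z)\<^sup>2) \<ge> u} \<in> sets N" by measurable
    have "measure D {z \<in> space D. sqrt (\<Sum>k<r. (G k z)\<^sup>2) \<ge> u} =
        measure P (obs m -` {z \<in> space N. sqrt (\<Sum>k<r. (G k z)\<^sup>2) \<ge> u} \<inter> space P)"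
      unfolding D_def using measure_distr[OF v(2) meas] by simp
    also have "obs m -` {z \<in> space N. sqrt (\<Sum>k<r. (G k z)\<^sup>2) \<ge> u} \<inter> space P =
        {\<omega> \<in> space P. norm_two (marg_est m j (obs m \<omega>) 0) \<ge> u}"
      using measurable_space[OF v(2)] by (auto simp: est norm_two_vec)
    also have "measure P \<dots> \<le> K * exp (- a * u powr \<gamma>)" unfolding P_def by (rule tail[OF u])
    finally show "measure D {z \<in> space D. sqrt (\<Sum>k<r. (G k z)\<^sup>2) \<ge> u} \<le> K * exp (- a * u powr \<gamma>)" .
  qed (use pos in auto)
  have second: "marg_second_moment m j = Matrix.mat r r (\<lambda>(k, l). \<integral>z. G k z * G l z \<partial>D)"
    unfolding marg_second_moment_def r_def[symmetric]
    by (rule eq_matI) (auto simp: int_D borel_measurable_times G_N G_def[symmetric] P_def[symmetric])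
  interpret W: tailed_vector D G r K a \<gamma> c
  proof unfold_locales
    fix v :: "nat \<Rightarrow> real"
    have "c * (\<Sum>k<r. (v k)\<^sup>2) \<le> lambda_min (marg_second_moment m j) * (\<Sum>k<r. (v k)\<^sup>2)"
      using eig by (intro mult_right_mono sum_nonneg) auto
    also have "\<dots> \<le> quad_form r (\<lambda>k l. \<integral>z. G k z * G l z \<partial>D) v"
      unfolding second by (rule lambda_min_le_quad_form) (use r in \<open>simp_all add: mult.commute\<close>)
    also have "\<dots> = (\<integral>z. (\<Sum>k<r. v k * G k z)\<^sup>2 \<partial>D)" by (rule W.integral_inner_sq[symmetric])
    finally show "c * (\<Sum>k<r. (v k)\<^sup>2) \<le> (\<integral>z. (\<Sum>k<r. v k * G k z)\<^sup>2 \<partial>D)" .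
  qed (use pos in auto)
  have "iid_sample P D (sample m) n"
  proof (intro iid_sample.intro iid_sample_axioms.intro)
    show "P.indep_vars (\<lambda>_. D) (sample m) {1..n}"
      by (rule P.indep_vars_sets_cong[OF v(3)]) (simp add: sets_D)
    show "distr P D (sample m i) = D" if "i \<in> {1..n}" for i
      using v(4)[OF that] distr_cong[of P P D N "sample m i" "sample m i"] sets_D by simp
  qed (use v n in auto)
  then interpret S: iid_sample P D "sample m" n .
  interpret tailed_sample P D "sample m" n G r K a \<gamma> c ..
  have "marg_mean m j = Matrix.vec r (\<lambda>k. \<integral>z. G k z \<partial>D)"
    unfolding marg_mean_def r_def[symmetric]
    by (rule eq_vecI) (auto simp: int_D G_N G_def[symmetric] P_def[symmetric])
  then have mean: "\<bar>\<integral>z. G k z \<partial>D\<bar> \<le> norm_inf (marg_mean m j)" if "k < r" for k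
    using norm_inf_vec_ge[OF that, of "\<lambda>k. \<integral>z. G k z \<partial>D"] by simp
  have bias': "\<bar>\<integral>z. G k z \<partial>D\<bar> + weibull_moment K a \<gamma> (q + 1) / T ^ q \<le> t / 2" if "k < r" for k
    using mean[OF that] bias unfolding M_def by linarith
  obtain E where E: "E \<in> sets P"
    "measure P E \<le> real n * (K * exp (- a * T powr \<gamma>)) + 2 * (M 2 / c)\<^sup>2 * exp (- gram_rate K a \<gamma> c * real n)
       + 2 * (M 2 / c) * exp (- real n * t / 4 * min (1 / T) (t / (4 * M 2)))"
    "\<And>\<omega>. \<omega> \<in> space P - E \<Longrightarrow> \<exists>w. (\<forall>i\<in>{1..n}. w i > 0) \<and> (\<Sum>i=1..n. w i) = 1 \<and>
        (\<forall>k<r. (\<Sum>i=1..n. w i * G k (sample m i \<omega>)) = 0) \<and>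
        - 2 * (\<Sum>i=1..n. ln (real n * w i)) \<le> 256 * real n * L\<^sup>2 / c\<^sup>2 * (M 2 / c * t\<^sup>2)"
    using weights_off_bad_event[OF T t bias' small[unfolded M_def L_def]] unfolding M_def L_def by blast
  show ?thesis
  proof
    show "E \<in> sets (prob_sp m)" using E(1) by (simp add: P_def)
    show "measure (prob_sp m) E \<le> real n * (K * exp (- a * T powr \<gamma>)) + 2 * (M 2 / c)\<^sup>2 * exp (- gram_rate K a \<gamma> c * real n)
       + 2 * (M 2 / c) * exp (- real n * t / 4 * min (1 / T) (t / (4 * M 2)))"
      using E(2) by (simp add: P_def)
    fix \<omega> assume "\<omega> \<in> space (prob_sp m) - E"
    then obtain w where w: "\<forall>i\<in>{1..n}. w i > 0" "(\<Sum>i=1..n. w i) = 1"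
      "\<forall>k<r. (\<Sum>i=1..n. w i * G k (sample m i \<omega>)) = 0"
      "- 2 * (\<Sum>i=1..n. ln (real n * w i)) \<le> 256 * real n * L\<^sup>2 / c\<^sup>2 * (M 2 / c * t\<^sup>2)"
      using E(3)[of \<omega>] unfolding P_def by blast
    have "marg_ELR n m j \<omega> \<le> ereal (- 2 * (\<Sum>i=1..n. ln (real n * w i)))"
      using w by (intro marg_ELR_le n) (auto simp: r_def G_def)
    also have "\<dots> \<le> ereal (256 * real n * L\<^sup>2 / c\<^sup>2 * (M 2 / c * t\<^sup>2))" using w(4) by simp
    finally show "marg_ELR n m j \<omega> \<le> ereal (256 * real n * L\<^sup>2 / c\<^sup>2 * (M 2 / c * t\<^sup>2))" .
  qed
qed

text \<open>
  If no coordinate outside the true model is selected, the selection is contained in the true model. The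
  overselection event itself need not be measurable, so it is covered by measurable bad events.
\<close>

lemma overselect_prob_le_union:
  assumes P: "prob_space (prob_sp m)" and B: "B \<ge> 0"
    and bad: "\<And>j. j \<in> {1..dim_par m} - true_model m \<Longrightarrow>
      \<exists>E\<in>sets (prob_sp m). measure (prob_sp m) E \<le> B \<and>
        (\<forall>\<omega>\<in>space (prob_sp m) - E. marg_ELR n m j \<omega> < ereal \<gamma>)"
  shows "overselect_prob n m \<gamma> \<le> real (dim_par m) * B"
proof -
  interpret prob_space "prob_sp m" by (rule P)
  let ?N = "{1..dim_par m} - true_model m"
  obtain E where E: "\<And>j. j \<in> ?N \<Longrightarrow> E j \<in> events" "\<And>j. j \<in> ?N \<Longrightarrow> prob (E j) \<le> B"
    "\<And>j \<omega>. j \<in> ?N \<Longrightarrow> \<omega> \<in> space (prob_sp m) - E j \<Longrightarrow> marg_ELR n m j \<omega> < ereal \<gamma>"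
    using bad by metis
  have sub: "{\<omega> \<in> space (prob_sp m). card (selected n m \<gamma> \<omega>) > card (true_model m)} \<subseteq> (\<Union>j\<in>?N. E j)"
  proof clarify
    fix \<omega> assume w: "\<omega> \<in> space (prob_sp m)" "card (selected n m \<gamma> \<omega>) > card (true_model m)"
    have "finite (true_model m)" by (simp add: true_model_def)
    then have "\<not> selected n m \<gamma> \<omega> \<subseteq> true_model m" using w(2) card_mono leD by blast
    then obtain j where j: "j \<in> ?N" "marg_ELR n m j \<omega> \<ge> ereal \<gamma>"
      by (auto simp: selected_def)
    then have "\<omega> \<in> E j" using E(3)[OF j(1), of \<omega>] w(1) by (meson DiffI leD)
    then show "\<omega> \<in> (\<Union>j\<in>?N. E j)" using j(1) by blast
  qed
  have "overselect_prob n m \<gamma> \<le> prob (\<Union>j\<in>?N. E j)"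
    unfolding overselect_prob_def using E(1) by (intro finite_measure_mono sub) auto
  also have "\<dots> \<le> (\<Sum>j\<in>?N. prob (E j))"
    using E(1) by (intro finite_measure_subadditive_finite) auto
  also have "\<dots> \<le> (\<Sum>j\<in>?N. B)" using E(2) by (intro sum_mono)
  also have "\<dots> \<le> real (dim_par m) * B"
    using B card_mono[of "{1..dim_par m}" ?N] by (auto intro!: mult_right_mono)
  finally show ?thesis .
qed

text \<open>
  Selecting more coordinates than a nonempty true model requires at least two coordinates, and then the
  right-hand side is at least \<open>2 * exp (- ln 2) = 1\<close>.
\<close>

lemma overselect_prob_trivial:
  assumes P: "prob_space (prob_sp m)" and "true_model m \<noteq> {}" and x: "0 \<le> x" "x \<le> 1" and C: "C \<le> ln 2"
  shows "overselect_prob n m \<gamma> \<le> real (dim_par m) * exp (- C * x)"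
proof -
  interpret prob_space "prob_sp m" by (rule P)
  have half: "exp (- C * x) \<ge> 1 / 2"
  proof -
    have "C * x \<le> ln 2 * x" using C x by (intro mult_right_mono) auto
    also have "\<dots> \<le> ln 2 * 1" using x by (intro mult_left_mono) auto
    finally have "exp (- ln 2) \<le> exp (- C * x)" by simp
    then show ?thesis by (simp add: exp_minus inverse_eq_divide)
  qed
  show ?thesis
  proof (cases "dim_par m \<ge> 2")
    case True
    have "overselect_prob n m \<gamma> \<le> 1" unfolding overselect_prob_def by (rule prob_le_1)
    also have "\<dots> \<le> real (dim_par m) * (1 / 2)" using True by simp
    also have "\<dots> \<le> real (dim_par m) * exp (- C * x)" using half by (intro mult_left_mono) auto
    finally show ?thesis .
  next
    case False
    have "card (true_model m) \<ge> 1"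
      using assms(2) by (simp add: Suc_le_eq card_gt_0_iff true_model_def)
    moreover have "card (selected n m \<gamma> \<omega>) \<le> 1" for \<omega>
    proof -
      have "card (selected n m \<gamma> \<omega>) \<le> card {1..dim_par m}"
        by (intro card_mono) (auto simp: selected_def)
      then show ?thesis using False by simp
    qed
    ultimately have "\<not> card (selected n m \<gamma> \<omega>) > card (true_model m)" for \<omega>
      by (meson le_trans leD)
    then have "overselect_prob n m \<gamma> = 0" by (simp add: overselect_prob_def)
    then show ?thesis by simp
  qed
qed

section \<open>Comparison of the exponential rates\<close>

text \<open>
  A larger exponent beats any constant; for equal exponents, half of the constant \<open>D\<close> is enough to absorb
  the factor \<open>A * n\<close>.
\<close>

lemma exp_powr_absorb:
  fixes A D C e \<alpha> :: real
  assumes "D > 0" "e > 0" "A \<ge> 0" and "\<alpha> < e \<or> \<alpha> \<le> e \<and> C \<le> D / 2"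
  shows "\<forall>\<^sub>F n in sequentially. A * real n * exp (- D * real n powr e) \<le> exp (- C * real n powr \<alpha>) / 4"
proof -
  have "\<forall>\<^sub>F n in sequentially. C * real n powr \<alpha> \<le> D / 2 * real n powr e"
  proof (cases "\<alpha> < e")
    case True
    have "(\<lambda>n. C * real n powr (\<alpha> - e)) \<longlonglongrightarrow> 0"
      using True by real_asymp
    then have "\<forall>\<^sub>F n in sequentially. C * real n powr (\<alpha> - e) < D / 2"
      using assms(1) by (intro order_tendstoD(2)) auto
    then show ?thesis using eventually_gt_at_top[of 0]
    proof eventually_elim
      case (elim n)
      then have "C * real n powr (\<alpha> - e) * real n powr e \<le> D / 2 * real n powr e"
        by (intro mult_right_mono) auto
      then show ?case using elim(2) by (simp add: mult.assoc powr_add[symmetric])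
    qed
  next
    case False
    then have "\<alpha> = e" "C \<le> D / 2" using assms(4) by auto
    then have "C * real n powr \<alpha> \<le> D / 2 * real n powr e" for n :: nat
      by (simp only: \<open>\<alpha> = e\<close>) (intro mult_right_mono, auto)
    then show ?thesis by simp
  qed
  moreover have "\<forall>\<^sub>F n in sequentially. A * real n * exp (- (D / 2) * real n powr e) \<le> 1 / 4"
  proof -
    have "(\<lambda>n. A * (real n * exp (- (D / 2) * real n powr e))) \<longlonglongrightarrow> A * 0"
      using assms(1,2) by (intro tendsto_mult_left) real_asymp
    then have "\<forall>\<^sub>F n in sequentially. A * (real n * exp (- (D / 2) * real n powr e)) < 1 / 4"
      by (intro order_tendstoD(2)) auto
    then show ?thesis by eventually_elim (simp add: mult.assoc)
  qed
  ultimately show ?thesis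
  proof eventually_elim
    case (elim n)
    have "A * real n * exp (- D * real n powr e) =
        A * real n * exp (- (D / 2) * real n powr e) * exp (- (D / 2 * real n powr e))"
      by (simp add: mult.assoc exp_add[symmetric])
    also have "\<dots> \<le> 1 / 4 * exp (- (D / 2 * real n powr e))"
      using elim(2) by (intro mult_right_mono) auto
    also have "\<dots> \<le> 1 / 4 * exp (- C * real n powr \<alpha>)"
      using elim(1) by simp
    finally show ?case by simp
  qed
qed

text \<open>
  If the linear regime applies, then \<open>t \<ge> 4 * B / T\<close>, and the linear rate \<open>n * t / (4 * T)\<close> is at least
  \<open>B * n / T\<^sup>2\<close>. This removes the dependence on \<open>t\<close> from that regime.
\<close>

lemma exp_min_rate_le:
  fixes n t T B :: real
  assumes "n > 0" "t > 0" "T > 0" "B > 0"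
  shows "exp (- n * t / 4 * min (1 / T) (t / (4 * B))) \<le> exp (- n * t\<^sup>2 / (16 * B)) + exp (- B * n / T\<^sup>2)"
proof (cases "t / (4 * B) \<le> 1 / T")
  case True
  then have "- n * t / 4 * min (1 / T) (t / (4 * B)) = - n * t\<^sup>2 / (16 * B)"
    by (simp add: min_def power2_eq_square)
  then show ?thesis by simp
next
  case False
  then have "4 * B / T \<le> t" using assms by (simp add: field_simps)
  then have "n * (4 * B / T) / 4 * (1 / T) \<le> n * t / 4 * (1 / T)"
    using assms by (intro mult_right_mono divide_right_mono mult_left_mono) auto
  then have "exp (- n * t / 4 * min (1 / T) (t / (4 * B))) \<le> exp (- B * n / T\<^sup>2)"
    using False by (simp add: min_def power2_eq_square mult_ac)
  then show ?thesis by (simp add: add_increasing)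
qed

text \<open>
  Truncation at \<open>T = n powr \<rho>\<close> and deviations \<open>t = \<epsilon> * n powr (\<tau> - 1/2)\<close>, where \<open>\<epsilon>\<close> is such that the bound for
  the log-likelihood ratio is half of the threshold. Since \<open>t\<close> tends to \<open>0\<close> but dominates both
  \<open>n powr (- \<eta>)\<close> and, for a moment of high enough order, the truncation bias, all requirements on a single null
  coordinate hold for large \<open>n\<close>, uniformly in the coordinate.
\<close>

lemma overselect_prob_eventually_le:
  fixes m :: "nat \<Rightarrow> 'a ee_model" and K a \<gamma> c c\<^sub>3 \<rho> \<eta> \<tau> :: real
  defines "M \<equiv> weibull_moment K a \<gamma> 2" and "L \<equiv> clip_level K a \<gamma> c"
  assumes pos: "a > 0" "\<gamma> > 0" "K > 0" "c > 0" "c\<^sub>3 > 0" "\<rho> > 0"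
    and \<tau>: "0 < \<tau>" "\<tau> < 1/2" "1/2 - \<eta> < \<tau>"
    and valid: "\<And>n. n \<ge> 1 \<Longrightarrow> valid_model n (m n)"
    and tail: "tail_bound m K a \<gamma>" and eig: "null_eigen_bound m c"
    and bigo: "(\<lambda>n. null_mean_max (m n)) \<in> O(\<lambda>n. real n powr (- \<eta>))"
  shows "\<forall>\<^sub>F n in sequentially. overselect_prob n (m n) (c\<^sub>3 * real n powr (2 * \<tau>)) \<le> real (dim_par (m n)) *
    (K * real n * exp (- a * real n powr (\<rho> * \<gamma>)) + 2 * (M / c)\<^sup>2 * real n * exp (- gram_rate K a \<gamma> c * real n powr 1)
     + (2 * (M / c) * real n * exp (- (c\<^sub>3 * c ^ 3 / (8192 * L\<^sup>2 * M\<^sup>2)) * real n powr (2 * \<tau>))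
     + 2 * (M / c) * real n * exp (- M * real n powr (1 - 2 * \<rho>))))"
proof -
  have M: "M > 0" using weibull_moment_ge_1[OF pos(1-3), of 2] by (simp add: M_def)
  have L: "L > 0" using weibull_moment_ge_1[OF pos(1-3), of 3] pos by (simp add: L_def clip_level_def)
  define \<epsilon> where "\<epsilon> = sqrt (c\<^sub>3 * c ^ 3 / (512 * L\<^sup>2 * M))"
  have \<epsilon>: "\<epsilon> > 0" "\<epsilon>\<^sup>2 = c\<^sub>3 * c ^ 3 / (512 * L\<^sup>2 * M)"
    using pos M L by (auto simp: \<epsilon>_def)
  \<comment> \<open>With a moment of order \<open>q + 1\<close> the truncation bias is \<open>O(n powr (- \<rho> * q))\<close>, below \<open>n powr (-1/2)\<close>.\<close>
  obtain q :: nat where q: "1 / (2 * \<rho>) < real q" using reals_Archimedean2 by blast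
  then have q: "1 / 2 < \<rho> * real q" using pos by (simp add: field_simps)
  define Mq where "Mq = weibull_moment K a \<gamma> (q + 1)"
  obtain C where C: "\<forall>\<^sub>F n in sequentially. norm (null_mean_max (m n)) \<le> C * norm (real n powr (- \<eta>))"
    using bigo by (elim landau_o.bigE)
  have "(\<lambda>n. C * real n powr (- \<eta> - (\<tau> - 1/2)) + Mq * real n powr (- (\<rho> * real q) - (\<tau> - 1/2))) \<longlonglongrightarrow> C * 0 + Mq * 0"
  proof (intro tendsto_intros)
    show "(\<lambda>n. real n powr (- \<eta> - (\<tau> - 1/2))) \<longlonglongrightarrow> 0" using \<tau> by real_asymp
    show "(\<lambda>n. real n powr (- (\<rho> * real q) - (\<tau> - 1/2))) \<longlonglongrightarrow> 0"
      using \<tau> q by (intro tendsto_neg_powr filterlim_real_sequentially) auto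
  qed
  then have bias: "\<forall>\<^sub>F n in sequentially. C * real n powr (- \<eta> - (\<tau> - 1/2)) + Mq * real n powr (- (\<rho> * real q) - (\<tau> - 1/2)) < \<epsilon> / 2"
    using \<epsilon> by (intro order_tendstoD(2)) auto
  have "(\<lambda>n. 16 * L * sqrt (M / c) * (\<epsilon> * real n powr (\<tau> - 1/2))) \<longlonglongrightarrow> 16 * L * sqrt (M / c) * (\<epsilon> * 0)"
    by (intro tendsto_intros) (use \<tau> in real_asymp)
  then have small: "\<forall>\<^sub>F n in sequentially. 16 * L * sqrt (M / c) * (\<epsilon> * real n powr (\<tau> - 1/2)) < c"
    using pos by (intro order_tendstoD(2)) auto
  show ?thesis
    using C bias small eventually_ge_at_top[of 1]
  proof eventually_elim
    case (elim n)
    define x where "x = real n"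
    have x: "x \<ge> 1" using elim(4) by (simp add: x_def)
    define t T where "t = \<epsilon> * x powr (\<tau> - 1/2)" and "T = x powr \<rho>"
    have tT: "t > 0" "T > 0" using \<epsilon> x by (auto simp: t_def T_def)
    have xt2: "x * t\<^sup>2 = \<epsilon>\<^sup>2 * x powr (2 * \<tau>)"
    proof -
      have "x * t\<^sup>2 = \<epsilon>\<^sup>2 * (x powr 1 * (x powr (\<tau> - 1/2) * x powr (\<tau> - 1/2)))"
        using x by (simp add: t_def power2_eq_square)
      also have "x powr 1 * (x powr (\<tau> - 1/2) * x powr (\<tau> - 1/2)) = x powr (2 * \<tau>)"
        unfolding powr_add[symmetric] by (simp add: algebra_simps)
      finally show ?thesis .
    qed
    have xT2: "x / T\<^sup>2 = x powr (1 - 2 * \<rho>)"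
    proof -
      have "T\<^sup>2 = x powr (2 * \<rho>)" unfolding T_def power2_eq_square powr_add[symmetric] by simp
      then show ?thesis using x by (simp add: powr_diff)
    qed
    have Tq: "T ^ q = x powr (\<rho> * real q)"
      unfolding T_def using x by (simp add: powr_power mult.commute)
    have bias_t: "C * x powr (- \<eta>) + Mq / T ^ q \<le> t / 2"
    proof -
      have "C * x powr (- \<eta>) + Mq / T ^ q =
          (C * x powr (- \<eta> - (\<tau> - 1/2)) + Mq * x powr (- (\<rho> * real q) - (\<tau> - 1/2))) * x powr (\<tau> - 1/2)"
      proof -
        have "x powr (u - w) * x powr w = x powr u" for u w by (simp flip: powr_add)
        then show ?thesis unfolding Tq distrib_right mult.assoc by (simp add: powr_minus_divide)
      qed
      also have "\<dots> \<le> \<epsilon> / 2 * x powr (\<tau> - 1/2)"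
        using elim(2) x by (intro mult_right_mono) (auto simp: x_def)
      finally show ?thesis by (simp add: t_def)
    qed
    define B where "B = real n * (K * exp (- a * T powr \<gamma>)) + 2 * (M / c)\<^sup>2 * exp (- gram_rate K a \<gamma> c * real n)
       + 2 * (M / c) * exp (- real n * t / 4 * min (1 / T) (t / (4 * M)))"
    have "overselect_prob n (m n) (c\<^sub>3 * x powr (2 * \<tau>)) \<le> real (dim_par (m n)) * B"
    proof (rule overselect_prob_le_union)
      show "prob_space (prob_sp (m n))" using valid[OF elim(4)] by (simp add: valid_model_def)
      show "0 \<le> B" unfolding B_def using M pos by (intro add_nonneg_nonneg mult_nonneg_nonneg) auto
      fix j assume j: "j \<in> {1..dim_par (m n)} - true_model (m n)"
      have "norm_inf (marg_mean (m n) j) \<le> null_mean_max (m n)"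
        unfolding null_mean_max_def using j by (intro Max_ge) auto
      also have "\<dots> \<le> C * x powr (- \<eta>)" using elim(1) by (simp add: x_def abs_le_iff)
      finally have b: "norm_inf (marg_mean (m n) j) + weibull_moment K a \<gamma> (q + 1) / T ^ q \<le> t / 2"
        using bias_t by (simp add: Mq_def)
      have s: "16 * clip_level K a \<gamma> c * sqrt (weibull_moment K a \<gamma> 2 / c) * t \<le> c"
        using elim(3) by (simp add: t_def x_def M_def L_def)
      have tl: "measure (prob_sp (m n)) {\<omega> \<in> space (prob_sp (m n)). norm_two (marg_est (m n) j (obs (m n) \<omega>) 0) \<ge> u}
          \<le> K * exp (- a * u powr \<gamma>)" if "u > 0" for u
        using tail that j elim(4) unfolding tail_bound_def by blast
      have eg: "lambda_min (marg_second_moment (m n) j) \<ge> c"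
        using eig j elim(4) unfolding null_eigen_bound_def by blast
      have n0: "n > 0" and j1: "j \<in> {1..dim_par (m n)}" using elim(4) j by auto
      obtain E where E: "E \<in> sets (prob_sp (m n))" "measure (prob_sp (m n)) E \<le> B"
        "\<And>\<omega>. \<omega> \<in> space (prob_sp (m n)) - E \<Longrightarrow>
           marg_ELR n (m n) j \<omega> \<le> ereal (256 * real n * L\<^sup>2 / c\<^sup>2 * (M / c * t\<^sup>2))"
        unfolding B_def M_def L_def
        using null_coordinate_ELR_bound[OF valid[OF elim(4)] n0 j1 pos(1-4) tl eg tT(2) tT(1) b s] by blast
      have "256 * real n * L\<^sup>2 / c\<^sup>2 * (M / c * t\<^sup>2) = 256 * L\<^sup>2 * M / c ^ 3 * (x * t\<^sup>2)"
        using pos by (simp add: x_def power2_eq_square power3_eq_cube)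
      also have "\<dots> = c\<^sub>3 / 2 * x powr (2 * \<tau>)"
        unfolding xt2 \<epsilon>(2) using pos M L by (simp add: field_simps)
      also have "\<dots> < c\<^sub>3 * x powr (2 * \<tau>)" using pos x by simp
      finally have "256 * real n * L\<^sup>2 / c\<^sup>2 * (M / c * t\<^sup>2) < c\<^sub>3 * x powr (2 * \<tau>)" .
      then show "\<exists>E\<in>sets (prob_sp (m n)). measure (prob_sp (m n)) E \<le> B \<and>
        (\<forall>\<omega>\<in>space (prob_sp (m n)) - E. marg_ELR n (m n) j \<omega> < ereal (c\<^sub>3 * x powr (2 * \<tau>)))"
        using E(1,2) by (intro bexI[OF _ E(1)] conjI ballI le_less_trans[OF E(3)]) simp_all
    qed
    also have "real (dim_par (m n)) * B \<le> real (dim_par (m n)) *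
      (K * x * exp (- a * x powr (\<rho> * \<gamma>)) + 2 * (M / c)\<^sup>2 * x * exp (- gram_rate K a \<gamma> c * x powr 1)
      + (2 * (M / c) * x * exp (- (c\<^sub>3 * c ^ 3 / (8192 * L\<^sup>2 * M\<^sup>2)) * x powr (2 * \<tau>))
       + 2 * (M / c) * x * exp (- M * x powr (1 - 2 * \<rho>))))"
    proof (intro mult_left_mono)
      have 1: "real n * (K * exp (- a * T powr \<gamma>)) = K * x * exp (- a * x powr (\<rho> * \<gamma>))"
        by (simp add: T_def x_def powr_powr)
      have 2: "2 * (M / c)\<^sup>2 * exp (- gram_rate K a \<gamma> c * real n) \<le> 2 * (M / c)\<^sup>2 * x * exp (- gram_rate K a \<gamma> c * x powr 1)"
        using mult_right_mono[OF mult_left_mono[OF x, of "2 * (M / c)\<^sup>2"], of "exp (- gram_rate K a \<gamma> c * x)"] x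
        by (simp add: x_def)
      have "exp (- x * t / 4 * min (1 / T) (t / (4 * M))) \<le> exp (- x * t\<^sup>2 / (16 * M)) + exp (- M * x / T\<^sup>2)"
        by (rule exp_min_rate_le) (use x tT M in auto)
      also have "- x * t\<^sup>2 / (16 * M) = - (c\<^sub>3 * c ^ 3 / (8192 * L\<^sup>2 * M\<^sup>2)) * x powr (2 * \<tau>)"
      proof -
        have "- x * t\<^sup>2 / (16 * M) = - (\<epsilon>\<^sup>2 / (16 * M)) * x powr (2 * \<tau>)" using xt2 by simp
        also have "\<epsilon>\<^sup>2 / (16 * M) = c\<^sub>3 * c ^ 3 / (8192 * L\<^sup>2 * M\<^sup>2)"
          unfolding \<epsilon>(2) by (simp add: power2_eq_square)
        finally show ?thesis .
      qed
      also have "- M * x / T\<^sup>2 = - M * x powr (1 - 2 * \<rho>)" unfolding xT2[symmetric] by simp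
      finally have e: "exp (- x * t / 4 * min (1 / T) (t / (4 * M))) \<le>
        exp (- (c\<^sub>3 * c ^ 3 / (8192 * L\<^sup>2 * M\<^sup>2)) * x powr (2 * \<tau>)) + exp (- M * x powr (1 - 2 * \<rho>))" (is "_ \<le> ?e") .
      have "2 * (M / c) * exp (- x * t / 4 * min (1 / T) (t / (4 * M))) \<le> 2 * (M / c) * x * ?e"
      proof (rule mult_mono)
        show "2 * (M / c) \<le> 2 * (M / c) * x"
          using mult_left_mono[OF x, of "2 * (M / c)"] M pos by simp
      qed (use e x M pos in auto)
      then have 3: "2 * (M / c) * exp (- x * t / 4 * min (1 / T) (t / (4 * M))) \<le>
         2 * (M / c) * x * exp (- (c\<^sub>3 * c ^ 3 / (8192 * L\<^sup>2 * M\<^sup>2)) * x powr (2 * \<tau>))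
       + 2 * (M / c) * x * exp (- M * x powr (1 - 2 * \<rho>))"
        unfolding distrib_left .
      show "B \<le> K * x * exp (- a * x powr (\<rho> * \<gamma>)) + 2 * (M / c)\<^sup>2 * x * exp (- gram_rate K a \<gamma> c * x powr 1)
      + (2 * (M / c) * x * exp (- (c\<^sub>3 * c ^ 3 / (8192 * L\<^sup>2 * M\<^sup>2)) * x powr (2 * \<tau>))
       + 2 * (M / c) * x * exp (- M * x powr (1 - 2 * \<rho>)))"
        unfolding B_def using 1 2 3 unfolding x_def by linarith
    qed simp
    finally show ?case unfolding x_def .
  qed
qed

theorem theorem6:
  fixes c\<^sub>4 K\<^sub>3 K\<^sub>4 \<gamma>\<^sub>3 :: real
  assumes "c\<^sub>4 > 0" "K\<^sub>3 > 0" "K\<^sub>4 > 0" "\<gamma>\<^sub>3 > 0"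
  shows "\<exists>C\<^sub>5>0. \<forall>c\<^sub>3>0. \<exists>C\<^sub>5'>0. \<forall>(m :: nat \<Rightarrow> 'a ee_model) \<kappa> \<eta> \<tau>.
    (\<forall>n\<ge>1. valid_model n (m n)) \<longrightarrow>
    min_signal m c\<^sub>3 \<kappa> \<longrightarrow>
    tail_bound m K\<^sub>3 K\<^sub>4 \<gamma>\<^sub>3 \<longrightarrow>
    \<eta> > \<kappa> \<longrightarrow>
    (\<lambda>n. null_mean_max (m n)) \<in> O(\<lambda>n. real n powr (- \<eta>)) \<longrightarrow>
    null_eigen_bound m c\<^sub>4 \<longrightarrow>
    1/2 - \<eta> < \<tau> \<longrightarrow> \<tau> < 1/2 - \<kappa> \<longrightarrow>
    (\<forall>\<^sub>F n in sequentially.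
      let p = real (dim_par (m n));
          P = overselect_prob n (m n) (c\<^sub>3 * real n powr (2 * \<tau>))
      in
        (\<gamma>\<^sub>3 < 2 \<and> \<eta> > 1/4 \<longrightarrow>
           P \<le> p * exp (- C\<^sub>5' * real n powr (2 * \<tau>)) + p * exp (- C\<^sub>5' * real n powr (\<gamma>\<^sub>3 / 6))) \<and>
        (\<gamma>\<^sub>3 < 2 \<and> \<eta> \<le> 1/4 \<longrightarrow>
           P \<le> p * exp (- C\<^sub>5 * real n powr (\<gamma>\<^sub>3 * \<eta>)) + p * exp (- C\<^sub>5 * real n powr (\<gamma>\<^sub>3 / 6))) \<and>
        (\<gamma>\<^sub>3 \<ge> 2 \<and> \<eta> \<le> 1 / (\<gamma>\<^sub>3 + 2) \<longrightarrow>
           P \<le> p * exp (- C\<^sub>5 * real n powr (\<gamma>\<^sub>3 * \<eta>)) + p * exp (- C\<^sub>5 * real n powr (\<gamma>\<^sub>3 / 6))) \<and>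
        (\<gamma>\<^sub>3 \<ge> 4 \<and> \<eta> > 1 / (\<gamma>\<^sub>3 + 2) \<longrightarrow>
           P \<le> p * exp (- C\<^sub>5' * real n powr (\<gamma>\<^sub>3 / (\<gamma>\<^sub>3 + 2))) + p * exp (- C\<^sub>5' * real n powr (2 * \<tau>))) \<and>
        (2 \<le> \<gamma>\<^sub>3 \<and> \<gamma>\<^sub>3 < 4 \<and> \<eta> > 1 / (\<gamma>\<^sub>3 + 2) \<longrightarrow>
           P \<le> p * exp (- C\<^sub>5' * real n powr (\<gamma>\<^sub>3 / 6)) + p * exp (- C\<^sub>5' * real n powr (2 * \<tau>))))"
proof -
  define M where "M = weibull_moment K\<^sub>3 K\<^sub>4 \<gamma>\<^sub>3 2"
  define L where "L = clip_level K\<^sub>3 K\<^sub>4 \<gamma>\<^sub>3 c\<^sub>4"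
  define H where "H = gram_rate K\<^sub>3 K\<^sub>4 \<gamma>\<^sub>3 c\<^sub>4"
  define \<rho> where "\<rho> = min (1 / 6) (1 / (\<gamma>\<^sub>3 + 2))"
  have M: "M > 0" using weibull_moment_ge_1[OF assms(3,4,2), of 2] by (simp add: M_def)
  have L: "L > 0" using weibull_moment_ge_1[OF assms(3,4,2), of 3] assms(1) by (simp add: L_def clip_level_def)
  have H: "H > 0"
    using M L assms(1) by (simp add: H_def gram_rate_def gram_tol_def L_def[symmetric] M_def[symmetric])
  have \<rho>: "\<rho> > 0" using assms(4) by (simp add: \<rho>_def)
  have \<rho>_low: "\<rho> = 1 / 6" if "\<gamma>\<^sub>3 < 4"
    using that assms(4) by (simp add: \<rho>_def min_def field_simps)
  have \<rho>_high: "\<rho> = 1 / (\<gamma>\<^sub>3 + 2)" if "\<gamma>\<^sub>3 \<ge> 4"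
  proof -
    have "1 / (\<gamma>\<^sub>3 + 2) \<le> 1 / 6" using that by (intro divide_left_mono) auto
    then show ?thesis by (simp add: \<rho>_def)
  qed
  \<comment> \<open>Half of each rate constant is given up to absorb polynomial factors.\<close>
  define C\<^sub>5 where "C\<^sub>5 = min K\<^sub>4 (min H M) / 2"
  have C5: "C\<^sub>5 > 0" "C\<^sub>5 \<le> K\<^sub>4 / 2" "C\<^sub>5 \<le> M / 2"
    using assms M H by (auto simp: C\<^sub>5_def)
  show ?thesis
  proof (rule exI[of _ C\<^sub>5], rule conjI, rule C5(1), rule allI, rule impI)
    fix c\<^sub>3 :: real
    assume c3: "c\<^sub>3 > 0"
    define D where "D = c\<^sub>3 * c\<^sub>4 ^ 3 / (8192 * L\<^sup>2 * M\<^sup>2)"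
    have D: "D > 0" using c3 assms(1) L M by (simp add: D_def)
    \<comment> \<open>The bound \<open>ln 2\<close> is for nonpositive \<open>\<tau>\<close>, the bound \<open>D / 2\<close> for the rate that involves \<open>c\<^sub>3\<close>.\<close>
    define C\<^sub>5' where "C\<^sub>5' = min C\<^sub>5 (min (D / 2) (ln 2))"
    have C5': "C\<^sub>5' > 0" "C\<^sub>5' \<le> K\<^sub>4 / 2" "C\<^sub>5' \<le> M / 2" "C\<^sub>5' \<le> D / 2" "C\<^sub>5' \<le> ln 2"
      using C5 D by (auto simp: C\<^sub>5'_def)
    show "\<exists>C\<^sub>5'>0. \<forall>(m :: nat \<Rightarrow> 'a ee_model) \<kappa> \<eta> \<tau>.
    (\<forall>n\<ge>1. valid_model n (m n)) \<longrightarrow>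
    min_signal m c\<^sub>3 \<kappa> \<longrightarrow>
    tail_bound m K\<^sub>3 K\<^sub>4 \<gamma>\<^sub>3 \<longrightarrow>
    \<eta> > \<kappa> \<longrightarrow>
    (\<lambda>n. null_mean_max (m n)) \<in> O(\<lambda>n. real n powr (- \<eta>)) \<longrightarrow>
    null_eigen_bound m c\<^sub>4 \<longrightarrow>
    1/2 - \<eta> < \<tau> \<longrightarrow> \<tau> < 1/2 - \<kappa> \<longrightarrow>
    (\<forall>\<^sub>F n in sequentially.
      let p = real (dim_par (m n));
          P = overselect_prob n (m n) (c\<^sub>3 * real n powr (2 * \<tau>))
      in
        (\<gamma>\<^sub>3 < 2 \<and> \<eta> > 1/4 \<longrightarrow>
           P \<le> p * exp (- C\<^sub>5' * real n powr (2 * \<tau>)) + p * exp (- C\<^sub>5' * real n powr (\<gamma>\<^sub>3 / 6))) \<and>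
        (\<gamma>\<^sub>3 < 2 \<and> \<eta> \<le> 1/4 \<longrightarrow>
           P \<le> p * exp (- C\<^sub>5 * real n powr (\<gamma>\<^sub>3 * \<eta>)) + p * exp (- C\<^sub>5 * real n powr (\<gamma>\<^sub>3 / 6))) \<and>
        (\<gamma>\<^sub>3 \<ge> 2 \<and> \<eta> \<le> 1 / (\<gamma>\<^sub>3 + 2) \<longrightarrow>
           P \<le> p * exp (- C\<^sub>5 * real n powr (\<gamma>\<^sub>3 * \<eta>)) + p * exp (- C\<^sub>5 * real n powr (\<gamma>\<^sub>3 / 6))) \<and>
        (\<gamma>\<^sub>3 \<ge> 4 \<and> \<eta> > 1 / (\<gamma>\<^sub>3 + 2) \<longrightarrow>
           P \<le> p * exp (- C\<^sub>5' * real n powr (\<gamma>\<^sub>3 / (\<gamma>\<^sub>3 + 2))) + p * exp (- C\<^sub>5' * real n powr (2 * \<tau>))) \<and>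
        (2 \<le> \<gamma>\<^sub>3 \<and> \<gamma>\<^sub>3 < 4 \<and> \<eta> > 1 / (\<gamma>\<^sub>3 + 2) \<longrightarrow>
           P \<le> p * exp (- C\<^sub>5' * real n powr (\<gamma>\<^sub>3 / 6)) + p * exp (- C\<^sub>5' * real n powr (2 * \<tau>))))"
    proof (rule exI[of _ C\<^sub>5'], rule conjI, rule C5'(1), intro allI impI)
      fix m :: "nat \<Rightarrow> 'a ee_model" and \<kappa> \<eta> \<tau> :: real
      assume valid: "\<forall>n\<ge>1. valid_model n (m n)" and signal: "min_signal m c\<^sub>3 \<kappa>"
        and tail: "tail_bound m K\<^sub>3 K\<^sub>4 \<gamma>\<^sub>3" and \<eta>: "\<eta> > \<kappa>"
        and bigo: "(\<lambda>n. null_mean_max (m n)) \<in> O(\<lambda>n. real n powr (- \<eta>))"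
        and eig: "null_eigen_bound m c\<^sub>4" and \<tau>: "1/2 - \<eta> < \<tau>" "\<tau> < 1/2 - \<kappa>"
      define P where "P n = overselect_prob n (m n) (c\<^sub>3 * real n powr (2 * \<tau>))" for n
      define p where "p n = real (dim_par (m n))" for n
      define F where "F C \<alpha> n = exp (- C * real n powr \<alpha>)" for C \<alpha> :: real and n :: nat
      have \<kappa>: "\<kappa> \<ge> 0" using signal by (simp add: min_signal_def)
      have p0: "p n \<ge> 0" for n by (simp add: p_def)
      \<comment> \<open>Each of the four error terms must be absorbed by one of the two terms of the claimed bound.
        The exponent \<open>1\<close> belongs to the Gram matrix.\<close>
      have split_bound: "\<forall>\<^sub>F n in sequentially. P n \<le> p n * F C \<alpha> n + p n * F C \<beta> n"
        if pos: "0 < \<tau>"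
          and 1: "(\<alpha> < \<rho> * \<gamma>\<^sub>3 \<or> \<alpha> \<le> \<rho> * \<gamma>\<^sub>3 \<and> C \<le> K\<^sub>4 / 2) \<or> (\<beta> < \<rho> * \<gamma>\<^sub>3 \<or> \<beta> \<le> \<rho> * \<gamma>\<^sub>3 \<and> C \<le> K\<^sub>4 / 2)"
          and 2: "\<alpha> < 1 \<or> \<beta> < 1"
          and 3: "(\<alpha> < 2 * \<tau> \<or> \<alpha> \<le> 2 * \<tau> \<and> C \<le> D / 2) \<or> (\<beta> < 2 * \<tau> \<or> \<beta> \<le> 2 * \<tau> \<and> C \<le> D / 2)"
          and 4: "(\<alpha> < 1 - 2 * \<rho> \<or> \<alpha> \<le> 1 - 2 * \<rho> \<and> C \<le> M / 2) \<or> (\<beta> < 1 - 2 * \<rho> \<or> \<beta> \<le> 1 - 2 * \<rho> \<and> C \<le> M / 2)"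
        for C \<alpha> \<beta>
      proof -
        have absorb: "\<forall>\<^sub>F n in sequentially. A * real n * exp (- B * real n powr e) \<le> (F C \<alpha> n + F C \<beta> n) / 4"
          if "B > 0" "e > 0" "A \<ge> 0" and ex: "(\<alpha> < e \<or> \<alpha> \<le> e \<and> C \<le> B / 2) \<or> (\<beta> < e \<or> \<beta> \<le> e \<and> C \<le> B / 2)" for A B e
        proof -
          obtain x where x: "x \<in> {\<alpha>, \<beta>}" "x < e \<or> x \<le> e \<and> C \<le> B / 2" using ex by blast
          have "F C x n \<le> F C \<alpha> n + F C \<beta> n" for n using x(1) by (auto simp: F_def)
          then show ?thesis
            using exp_powr_absorb[OF that(1-3) x(2)]
            by (elim eventually_mono) (fastforce simp: F_def intro: order.trans)
        qed
        have \<rho>6: "\<rho> \<le> 1 / 6" by (simp add: \<rho>_def)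
        define b1 b2 b3 b4 where
          "b1 n = K\<^sub>3 * real n * exp (- K\<^sub>4 * real n powr (\<rho> * \<gamma>\<^sub>3))" and
          "b2 n = 2 * (M / c\<^sub>4)\<^sup>2 * real n * exp (- H * real n powr 1)" and
          "b3 n = 2 * (M / c\<^sub>4) * real n * exp (- D * real n powr (2 * \<tau>))" and
          "b4 n = 2 * (M / c\<^sub>4) * real n * exp (- M * real n powr (1 - 2 * \<rho>))" for n :: nat
        have "\<forall>\<^sub>F n in sequentially. b1 n \<le> (F C \<alpha> n + F C \<beta> n) / 4"
          unfolding b1_def by (rule absorb) (use assms \<rho> 1 in auto)
        moreover have "\<forall>\<^sub>F n in sequentially. b2 n \<le> (F C \<alpha> n + F C \<beta> n) / 4"
          unfolding b2_def by (rule absorb) (use H 2 in auto)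
        moreover have "\<forall>\<^sub>F n in sequentially. b3 n \<le> (F C \<alpha> n + F C \<beta> n) / 4"
          unfolding b3_def by (rule absorb) (use assms M D pos 3 in auto)
        moreover have "\<forall>\<^sub>F n in sequentially. b4 n \<le> (F C \<alpha> n + F C \<beta> n) / 4"
          unfolding b4_def by (rule absorb) (use assms M \<rho>6 4 in auto)
        moreover have "\<forall>\<^sub>F n in sequentially. P n \<le> p n * (b1 n + b2 n + (b3 n + b4 n))"
          unfolding P_def p_def b1_def b2_def b3_def b4_def M_def L_def H_def D_def
          by (rule overselect_prob_eventually_le[OF assms(3,4,2,1) c3 \<rho> pos _ \<tau>(1) _ tail eig bigo])
            (use \<tau> \<kappa> valid in auto)
        ultimately show ?thesis
        proof eventually_elim
          case (elim n)
          have "P n \<le> p n * (b1 n + b2 n + (b3 n + b4 n))" by (rule elim)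
          also have "\<dots> \<le> p n * (F C \<alpha> n + F C \<beta> n)"
          proof (rule mult_left_mono[OF _ p0])
            let ?S = "F C \<alpha> n + F C \<beta> n"
            have "b1 n + b2 n + (b3 n + b4 n) \<le> ?S / 4 + ?S / 4 + (?S / 4 + ?S / 4)"
              by (intro add_mono elim)
            also have "\<dots> = ?S" by simp
            finally show "b1 n + b2 n + (b3 n + b4 n) \<le> ?S" .
          qed
          finally show ?case by (simp add: distrib_left)
        qed
      qed
      have trivial: "\<forall>\<^sub>F n in sequentially. P n \<le> p n * F C\<^sub>5' (2 * \<tau>) n" if "\<tau> \<le> 0"
        using eventually_ge_at_top[of 1]
      proof eventually_elim
        case (elim n)
        have "real n powr (2 * \<tau>) \<le> real n powr 0" using elim that by (intro powr_mono) auto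
        then have "real n powr (2 * \<tau>) \<le> 1" using elim by simp
        then show ?case
          unfolding P_def p_def F_def using valid signal elim C5'
          by (intro overselect_prob_trivial) (auto simp: valid_model_def min_signal_def)
      qed
      have F_nonneg: "p n * F C \<alpha> n \<ge> 0" for C \<alpha> n using p0 by (simp add: F_def)
      have case1: "\<forall>\<^sub>F n in sequentially. P n \<le> p n * F C\<^sub>5' (2 * \<tau>) n + p n * F C\<^sub>5' (\<gamma>\<^sub>3 / 6) n"
        if "\<gamma>\<^sub>3 < 2"
      proof (cases "\<tau> > 0")
        case True
        then show ?thesis using that C5' by (intro split_bound) (auto simp: \<rho>_low)
      next
        case False
        then show ?thesis using trivial by (auto elim!: eventually_mono intro: add_increasing2[OF F_nonneg])
      qed
      have case2: "\<forall>\<^sub>F n in sequentially. P n \<le> p n * F C\<^sub>5 (\<gamma>\<^sub>3 * \<eta>) n + p n * F C\<^sub>5 (\<gamma>\<^sub>3 / 6) n"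
        if "\<gamma>\<^sub>3 < 2" "\<eta> \<le> 1 / 4"
      proof -
        have "\<gamma>\<^sub>3 * \<eta> \<le> 2 * (1 / 4)" using that assms(4) \<eta> \<kappa> by (intro mult_mono) auto
        then have "\<gamma>\<^sub>3 * \<eta> < 2 * \<tau>" "0 < \<tau>" using \<tau> that by auto
        then show ?thesis using that C5 by (intro split_bound) (auto simp: \<rho>_low)
      qed
      \<comment> \<open>If \<open>\<gamma>\<^sub>3 < 4\<close>, the truncation rate is \<open>\<gamma>\<^sub>3 / 6\<close>; otherwise it is \<open>\<gamma>\<^sub>3 / (\<gamma>\<^sub>3 + 2) \<ge> \<gamma>\<^sub>3 * \<eta>\<close>.\<close>
      have case3: "\<forall>\<^sub>F n in sequentially. P n \<le> p n * F C\<^sub>5 (\<gamma>\<^sub>3 * \<eta>) n + p n * F C\<^sub>5 (\<gamma>\<^sub>3 / 6) n"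
        if "\<gamma>\<^sub>3 \<ge> 2" "\<eta> \<le> 1 / (\<gamma>\<^sub>3 + 2)"
      proof -
        have u: "1 / (\<gamma>\<^sub>3 + 2) \<le> 1 / 4" using that by (intro divide_left_mono) auto
        have g: "\<gamma>\<^sub>3 / (\<gamma>\<^sub>3 + 2) = 1 - 2 * (1 / (\<gamma>\<^sub>3 + 2))" using that by (simp add: field_simps)
        have "\<gamma>\<^sub>3 * \<eta> \<le> \<gamma>\<^sub>3 * (1 / (\<gamma>\<^sub>3 + 2))" using that by (intro mult_left_mono) auto
        then have le: "\<gamma>\<^sub>3 * \<eta> \<le> \<gamma>\<^sub>3 / (\<gamma>\<^sub>3 + 2)" by simp
        have "\<gamma>\<^sub>3 * \<eta> < 2 * \<tau>" "0 < \<tau>" using le g \<tau> that u by linarith+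
        moreover have "\<gamma>\<^sub>3 * \<eta> < 1" using le g that by (smt (verit) divide_pos_pos)
        moreover have "\<gamma>\<^sub>3 * \<eta> \<le> 1 - 2 * \<rho>"
          using le g by (simp add: \<rho>_def min_def split: if_splits)
        moreover have "\<gamma>\<^sub>3 / 6 \<le> \<rho> * \<gamma>\<^sub>3 \<or> \<gamma>\<^sub>3 * \<eta> \<le> \<rho> * \<gamma>\<^sub>3"
          using le by (cases "\<gamma>\<^sub>3 < 4") (simp_all add: \<rho>_low \<rho>_high)
        ultimately show ?thesis using C5 by (intro split_bound) auto
      qed
      have case4: "\<forall>\<^sub>F n in sequentially. P n \<le> p n * F C\<^sub>5' (\<gamma>\<^sub>3 / (\<gamma>\<^sub>3 + 2)) n + p n * F C\<^sub>5' (2 * \<tau>) n"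
        if "\<gamma>\<^sub>3 \<ge> 4"
      proof (cases "\<tau> > 0")
        case True
        have g: "\<gamma>\<^sub>3 / (\<gamma>\<^sub>3 + 2) = 1 - 2 * \<rho>" "\<gamma>\<^sub>3 / (\<gamma>\<^sub>3 + 2) = \<rho> * \<gamma>\<^sub>3"
          using that \<rho>_high by (auto simp: field_simps)
        then show ?thesis using True C5' \<rho> by (intro split_bound) auto
      next
        case False
        then show ?thesis using trivial by (auto elim!: eventually_mono intro: add_increasing[OF F_nonneg])
      qed
      have case5: "\<forall>\<^sub>F n in sequentially. P n \<le> p n * F C\<^sub>5' (\<gamma>\<^sub>3 / 6) n + p n * F C\<^sub>5' (2 * \<tau>) n"
        if "\<gamma>\<^sub>3 < 4"
      proof (cases "\<tau> > 0")
        case True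
        then show ?thesis using that C5' by (intro split_bound) (auto simp: \<rho>_low)
      next
        case False
        then show ?thesis using trivial by (auto elim!: eventually_mono intro: add_increasing[OF F_nonneg])
      qed
      have imp: "\<forall>\<^sub>F n in sequentially. A \<longrightarrow> R n" if "A \<Longrightarrow> \<forall>\<^sub>F n in sequentially. R n" for A :: bool and R :: "nat \<Rightarrow> bool"
        using that by (cases A) auto
      have "\<forall>\<^sub>F n in sequentially. \<gamma>\<^sub>3 < 2 \<and> \<eta> > 1 / 4 \<longrightarrow> P n \<le> p n * F C\<^sub>5' (2 * \<tau>) n + p n * F C\<^sub>5' (\<gamma>\<^sub>3 / 6) n"
        by (intro imp case1) auto
      moreover have "\<forall>\<^sub>F n in sequentially. \<gamma>\<^sub>3 < 2 \<and> \<eta> \<le> 1 / 4 \<longrightarrow> P n \<le> p n * F C\<^sub>5 (\<gamma>\<^sub>3 * \<eta>) n + p n * F C\<^sub>5 (\<gamma>\<^sub>3 / 6) n"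
        by (intro imp case2) auto
      moreover have "\<forall>\<^sub>F n in sequentially. \<gamma>\<^sub>3 \<ge> 2 \<and> \<eta> \<le> 1 / (\<gamma>\<^sub>3 + 2) \<longrightarrow> P n \<le> p n * F C\<^sub>5 (\<gamma>\<^sub>3 * \<eta>) n + p n * F C\<^sub>5 (\<gamma>\<^sub>3 / 6) n"
        by (intro imp case3) auto
      moreover have "\<forall>\<^sub>F n in sequentially. \<gamma>\<^sub>3 \<ge> 4 \<and> \<eta> > 1 / (\<gamma>\<^sub>3 + 2) \<longrightarrow> P n \<le> p n * F C\<^sub>5' (\<gamma>\<^sub>3 / (\<gamma>\<^sub>3 + 2)) n + p n * F C\<^sub>5' (2 * \<tau>) n"
        by (intro imp case4) auto
      moreover have "\<forall>\<^sub>F n in sequentially. 2 \<le> \<gamma>\<^sub>3 \<and> \<gamma>\<^sub>3 < 4 \<and> \<eta> > 1 / (\<gamma>\<^sub>3 + 2) \<longrightarrow> P n \<le> p n * F C\<^sub>5' (\<gamma>\<^sub>3 / 6) n + p n * F C\<^sub>5' (2 * \<tau>) n"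
        by (intro imp case5) auto
      ultimately show "(\<forall>\<^sub>F n in sequentially.
      let p = real (dim_par (m n));
          P = overselect_prob n (m n) (c\<^sub>3 * real n powr (2 * \<tau>))
      in
        (\<gamma>\<^sub>3 < 2 \<and> \<eta> > 1/4 \<longrightarrow>
           P \<le> p * exp (- C\<^sub>5' * real n powr (2 * \<tau>)) + p * exp (- C\<^sub>5' * real n powr (\<gamma>\<^sub>3 / 6))) \<and>
        (\<gamma>\<^sub>3 < 2 \<and> \<eta> \<le> 1/4 \<longrightarrow>
           P \<le> p * exp (- C\<^sub>5 * real n powr (\<gamma>\<^sub>3 * \<eta>)) + p * exp (- C\<^sub>5 * real n powr (\<gamma>\<^sub>3 / 6))) \<and>
        (\<gamma>\<^sub>3 \<ge> 2 \<and> \<eta> \<le> 1 / (\<gamma>\<^sub>3 + 2) \<longrightarrow>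
           P \<le> p * exp (- C\<^sub>5 * real n powr (\<gamma>\<^sub>3 * \<eta>)) + p * exp (- C\<^sub>5 * real n powr (\<gamma>\<^sub>3 / 6))) \<and>
        (\<gamma>\<^sub>3 \<ge> 4 \<and> \<eta> > 1 / (\<gamma>\<^sub>3 + 2) \<longrightarrow>
           P \<le> p * exp (- C\<^sub>5' * real n powr (\<gamma>\<^sub>3 / (\<gamma>\<^sub>3 + 2))) + p * exp (- C\<^sub>5' * real n powr (2 * \<tau>))) \<and>
        (2 \<le> \<gamma>\<^sub>3 \<and> \<gamma>\<^sub>3 < 4 \<and> \<eta> > 1 / (\<gamma>\<^sub>3 + 2) \<longrightarrow>
           P \<le> p * exp (- C\<^sub>5' * real n powr (\<gamma>\<^sub>3 / 6)) + p * exp (- C\<^sub>5' * real n powr (2 * \<tau>))))"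
        unfolding Let_def P_def[symmetric] p_def[symmetric] F_def[symmetric]
        by eventually_elim blast
    qed
  qed
qed

end
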